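(* Let $\Omega\subset\mathbb{R}^d$ be a bounded domain with Lipschitz boundary, $\partial\Omega=\overline{\Gamma_D}\cup\overline{\Gamma_N}$ with $\Gamma_D,\Gamma_N$ relatively open and disjoint, and $\operatorname{meas}_{d-1}\Gamma_N>0$. Let $\mathcal{A}\in[L^\infty(\Omega)]^{d\times d}$ be symmetric and uniformly positive definite, and $c\in L^\infty(\Omega)$, $\alpha\in L^\infty(\Gamma_N)$ nonnegative. Let $V=H^1_{\Gamma_D}(\Omega)=\{v\in H^1(\Omega):v=0\text{ on }\Gamma_D\}$, $a(u,v)=(\mathcal{A}\nabla u,\nabla v)+(cu,v)+(\alpha u,v)_{L^2(\Gamma_N)}$, and assume $a(\cdot,\cdot)$ is a scalar product on $V$ with norm $|||v|||=a(v,v)^{1/2}$. Let $C_F$ be the smallest constant with $\|v\|_{L^2(\Omega)}\le C_F|||v|||$ for all $v\in V$ and $C_T$ the smallest constant with $\|v\|_{L^2(\Gamma_N)}\le C_T|||v|||$ for all $v\in V$. Let $u_*\in V$, $\lambda_*\in\mathbb{R}$, and let $w\in V$ satisfy $$a(w,v)=a(u_*,v)-\lambda_*(u_*,v)_{L^2(\Gamma_N)}\quad\forall v\in V.$$ Then for any $\mathbf{q}\in H(\operatorname{div},\Omega)$, $$|||w|||\le\|\nabla u_*-\mathcal{A}^{-1}\mathbf{q}\|_{\mathcal{A}}+C_F\|cu_*-\operatorname{div}\mathbf{q}\|_{L^2(\Omega)}+C_T\|\alpha u_*-\lambda_*u_*+\mathbf{q}\cdot\mathbf{n}\|_{L^2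(\Gamma_N)}.$$
   Context: $(\cdot,\cdot)$ is the $L^2(\Omega)$ scalar product; $H(\operatorname{div},\Omega)$ is the space of $[L^2(\Omega)]^d$ fields with square integrable weak divergence; $\mathbf{n}$ is the unit outward normal to $\partial\Omega$; $\|\mathbf{q}\|_{\mathcal{A}}^2=(\mathcal{A}\mathbf{q},\mathbf{q})$. *)

theory Defs
  imports "HOL-Analysis.Analysis"
begin

definition hausdorff_pre :: "nat \<Rightarrow> real \<Rightarrow> 'a::euclidean_space set \<Rightarrow> ennreal" where
  "hausdorff_pre s \<delta> A =
     (INF C \<in> {C :: nat \<Rightarrow> 'a set. (\<forall>i. bounded (C i) \<and> diameter (C i) \<le> \<delta>) \<and> A \<subseteq> (\<Union>i. C i)}.
        (\<Sum>i. ennreal (unit_ball_vol (real s) / 2 ^ s *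
                         (if C i = {} then 0 else diameter (C i) ^ s))))"

definition hausdorff_outer :: "nat \<Rightarrow> 'a::euclidean_space set \<Rightarrow> ennreal" where
  "hausdorff_outer s A = (SUP \<delta> \<in> {0<..}. hausdorff_pre s \<delta> A)"

definition hausdorff_measure :: "nat \<Rightarrow> 'a::euclidean_space measure" where
  "hausdorff_measure s =
     measure_of UNIV
       {A. \<forall>B. hausdorff_outer s B = hausdorff_outer s (B \<inter> A) + hausdorff_outer s (B - A)}
       (hausdorff_outer s)"

definition surf :: "('a::euclidean_space) measure" where
  "surf = hausdorff_measure (DIM('a) - 1)"

definition lipschitz_domain :: "'a::euclidean_space set \<Rightarrow> bool" where
  "lipschitz_domain \<Omega> \<longleftrightarrow> bounded \<Omega> \<and> open \<Omega> \<and> connected \<Omega> \<and> \<Omega> \<noteq> {} \<and>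
     (\<forall>x \<in> frontier \<Omega>. \<exists>r > 0. \<exists>e L f. norm e = 1 \<and>
        lipschitz_on L {p. p \<bullet> e = 0} (f :: 'a \<Rightarrow> real) \<and>
        \<Omega> \<inter> ball x r = {y \<in> ball x r. y \<bullet> e < f (y - (y \<bullet> e) *\<^sub>R e)})"

definition pd :: "'n::finite \<Rightarrow> (real^'n \<Rightarrow> real) \<Rightarrow> real^'n \<Rightarrow> real" where
  "pd i f x = deriv (\<lambda>t. f (x + t *\<^sub>R axis i 1)) 0"

fun iter_pd :: "'n::finite list \<Rightarrow> (real^'n \<Rightarrow> real) \<Rightarrow> real^'n \<Rightarrow> real" where
  "iter_pd [] f = f"
| "iter_pd (i # is) f = pd i (iter_pd is f)"

definition smooth :: "(real^'n::finite \<Rightarrow> real) \<Rightarrow> bool" where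
  "smooth f \<longleftrightarrow> (\<forall>is. iter_pd is f differentiable_on UNIV)"

definition cgrad :: "(real^'n::finite \<Rightarrow> real) \<Rightarrow> real^'n \<Rightarrow> real^'n" where
  "cgrad f x = (\<chi> i. pd i f x)"

definition test_fun :: "(real^'n::finite) set \<Rightarrow> (real^'n \<Rightarrow> real) \<Rightarrow> bool" where
  "test_fun \<Omega> \<phi> \<longleftrightarrow> smooth \<phi> \<and> compact (closure {x. \<phi> x \<noteq> 0}) \<and>
                      closure {x. \<phi> x \<noteq> 0} \<subseteq> \<Omega>"

definition L2 :: "'a measure \<Rightarrow> 'a set \<Rightarrow> ('a \<Rightarrow> real) \<Rightarrow> bool" where
  "L2 M S f \<longleftrightarrow> set_borel_measurable M S f \<and> set_integrable M S (\<lambda>x. (f x)\<^sup>2)"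

definition L2_norm :: "'a measure \<Rightarrow> 'a set \<Rightarrow> ('a \<Rightarrow> real) \<Rightarrow> real" where
  "L2_norm M S f = sqrt (LINT x:S|M. (f x)\<^sup>2)"

definition Linf :: "'a measure \<Rightarrow> 'a set \<Rightarrow> ('a \<Rightarrow> real) \<Rightarrow> bool" where
  "Linf M S f \<longleftrightarrow> set_borel_measurable M S f \<and> (\<exists>K. AE x in M. x \<in> S \<longrightarrow> \<bar>f x\<bar> \<le> K)"

definition weak_grad :: "(real^'n::finite) set \<Rightarrow> (real^'n \<Rightarrow> real) \<Rightarrow> (real^'n \<Rightarrow> real^'n) \<Rightarrow> bool" where
  "weak_grad \<Omega> v G \<longleftrightarrow> (\<forall>\<phi>. test_fun \<Omega> \<phi> \<longrightarrow> (\<forall>i.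
      (LINT x:\<Omega>|lebesgue. v x * pd i \<phi> x) = - (LINT x:\<Omega>|lebesgue. G x $ i * \<phi> x)))"

definition H1 :: "(real^'n::finite) set \<Rightarrow> (real^'n \<Rightarrow> real) \<Rightarrow> bool" where
  "H1 \<Omega> v \<longleftrightarrow> L2 lebesgue \<Omega> v \<and>
     (\<exists>G. (\<forall>i. L2 lebesgue \<Omega> (\<lambda>x. G x $ i)) \<and> weak_grad \<Omega> v G)"

definition grad :: "(real^'n::finite) set \<Rightarrow> (real^'n \<Rightarrow> real) \<Rightarrow> real^'n \<Rightarrow> real^'n" where
  "grad \<Omega> v = (SOME G. (\<forall>i. L2 lebesgue \<Omega> (\<lambda>x. G x $ i)) \<and> weak_grad \<Omega> v G)"

definition trace_rel :: "(real^'n::finite) set \<Rightarrow> (real^'n \<Rightarrow> real) \<Rightarrow> (real^'n \<Rightarrow> real) \<Rightarrow> bool" where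
  "trace_rel \<Omega> v g \<longleftrightarrow> L2 surf (frontier \<Omega>) g \<and>
     (\<exists>\<phi> :: nat \<Rightarrow> real^'n \<Rightarrow> real. (\<forall>k. smooth (\<phi> k)) \<and>
        (\<lambda>k. L2_norm lebesgue \<Omega> (\<lambda>x. \<phi> k x - v x)) \<longlonglongrightarrow> 0 \<and>
        (\<forall>i. (\<lambda>k. L2_norm lebesgue \<Omega> (\<lambda>x. cgrad (\<phi> k) x $ i - grad \<Omega> v x $ i)) \<longlonglongrightarrow> 0) \<and>
        (\<lambda>k. L2_norm surf (frontier \<Omega>) (\<lambda>x. \<phi> k x - g x)) \<longlonglongrightarrow> 0)"

definition tr :: "(real^'n::finite) set \<Rightarrow> (real^'n \<Rightarrow> real) \<Rightarrow> real^'n \<Rightarrow> real" where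
  "tr \<Omega> v = (SOME g. trace_rel \<Omega> v g)"

definition H1_0 :: "(real^'n::finite) set \<Rightarrow> (real^'n) set \<Rightarrow> (real^'n \<Rightarrow> real) set" where
  "H1_0 \<Omega> \<Gamma>D = {v. H1 \<Omega> v \<and> (AE x in surf. x \<in> \<Gamma>D \<longrightarrow> tr \<Omega> v x = 0)}"

definition weak_div :: "(real^'n::finite) set \<Rightarrow> (real^'n \<Rightarrow> real^'n) \<Rightarrow> (real^'n \<Rightarrow> real) \<Rightarrow> bool" where
  "weak_div \<Omega> q D \<longleftrightarrow> (\<forall>\<phi>. test_fun \<Omega> \<phi> \<longrightarrow>
      (LINT x:\<Omega>|lebesgue. q x \<bullet> cgrad \<phi> x) = - (LINT x:\<Omega>|lebesgue. D x * \<phi> x))"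

definition Hdiv :: "(real^'n::finite) set \<Rightarrow> (real^'n \<Rightarrow> real^'n) \<Rightarrow> bool" where
  "Hdiv \<Omega> q \<longleftrightarrow> (\<forall>i. L2 lebesgue \<Omega> (\<lambda>x. q x $ i)) \<and>
     (\<exists>D. L2 lebesgue \<Omega> D \<and> weak_div \<Omega> q D)"

definition divg :: "(real^'n::finite) set \<Rightarrow> (real^'n \<Rightarrow> real^'n) \<Rightarrow> real^'n \<Rightarrow> real" where
  "divg \<Omega> q = (SOME D. L2 lebesgue \<Omega> D \<and> weak_div \<Omega> q D)"

text \<open>g in L^2(Gamma_N) is the normal trace q.n on Gamma_N (Green's formula, tested with V).\<close>
definition normal_trace_on :: "(real^'n::finite) set \<Rightarrow> (real^'n) set \<Rightarrow> (real^'n) set \<Rightarrow>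
     (real^'n \<Rightarrow> real^'n) \<Rightarrow> (real^'n \<Rightarrow> real) \<Rightarrow> bool" where
  "normal_trace_on \<Omega> \<Gamma>D \<Gamma>N q g \<longleftrightarrow> L2 surf \<Gamma>N g \<and>
     (\<forall>v \<in> H1_0 \<Omega> \<Gamma>D.
        (LINT x:\<Omega>|lebesgue. q x \<bullet> grad \<Omega> v x) + (LINT x:\<Omega>|lebesgue. divg \<Omega> q x * v x)
        = (LINT x:\<Gamma>N|surf. g x * tr \<Omega> v x))"

definition least_real :: "real set \<Rightarrow> real \<Rightarrow> bool" where
  "least_real S x \<longleftrightarrow> x \<in> S \<and> (\<forall>y \<in> S. x \<le> y)"

definition aform :: "(real^'n::finite) set \<Rightarrow> (real^'n) set \<Rightarrow> (real^'n \<Rightarrow> real^'n^'n) \<Rightarrow>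
     (real^'n \<Rightarrow> real) \<Rightarrow> (real^'n \<Rightarrow> real) \<Rightarrow> (real^'n \<Rightarrow> real) \<Rightarrow> (real^'n \<Rightarrow> real) \<Rightarrow> real" where
  "aform \<Omega> \<Gamma>N A c \<alpha> u v =
     (LINT x:\<Omega>|lebesgue. (A x *v grad \<Omega> u x) \<bullet> grad \<Omega> v x)
   + (LINT x:\<Omega>|lebesgue. c x * u x * v x)
   + (LINT x:\<Gamma>N|surf. \<alpha> x * tr \<Omega> u x * tr \<Omega> v x)"

definition scalar_product_on :: "('a \<Rightarrow> real) set \<Rightarrow> (('a \<Rightarrow> real) \<Rightarrow> ('a \<Rightarrow> real) \<Rightarrow> real) \<Rightarrow>
     'a measure \<Rightarrow> 'a set \<Rightarrow> bool" where
  "scalar_product_on V a M \<Omega> \<longleftrightarrow>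
     (\<forall>u\<in>V. \<forall>v\<in>V. a u v = a v u) \<and>
     (\<forall>u\<in>V. \<forall>v\<in>V. \<forall>w\<in>V. \<forall>s t. a (\<lambda>x. s * u x + t * v x) w = s * a u w + t * a v w) \<and>
     (\<forall>v\<in>V. a v v \<ge> 0) \<and>
     (\<forall>v\<in>V. a v v = 0 \<longrightarrow> (AE x in M. x \<in> \<Omega> \<longrightarrow> v x = 0))"

end

theory Submission
  imports Defs "HOL-Computational_Algebra.Polynomial"
begin

text \<open>
  Testing the equation for w with w itself and subtracting Green's formula for q gives
  \<open>|||w|||\<^sup>2 = (A (grad u - A\<^sup>-\<^sup>1 q), grad w) + (c u - div q, w) + (\<alpha> u - \<lambda> u + q\<cdot>n, w)\<close>, the last product
  being taken over \<open>\<Gamma>\<^sub>N\<close>; Cauchy-Schwarz in each term and division by \<open>|||w|||\<close> give the bound.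

  The trace operator is a choice function, so the boundary terms are meaningful only if \<open>u\<close> and \<open>w\<close>
  have traces. Instead of the trace theorem, the following suffices. All functions without a
  trace share one junk trace, and with \<open>v\<close> also \<open>2 v\<close> has no trace. Each identity tested with \<open>v\<close> and
  with \<open>2 v\<close> therefore shows, by linearity, that its boundary terms vanish. If \<open>w\<close> has no
  trace, only the volume terms remain. If \<open>w\<close> has a trace but \<open>u\<close> has not, then \<open>v = w - u\<close>
  has none and lies in the space of test functions; this gives \<open>a(v, v) = 0\<close>, so \<open>w = u\<close> almost
  everywhere, a contradiction. Linearity of the weak gradient rests on the fundamental lemma
  of the calculus of variations.
\<close>

section \<open>Bump functions\<close>

text \<open>The polynomial parameter makes the family p(1/t) exp(-1/t), extended by 0 to t \<le> 0,
  closed under differentiation; \<open>expdec 1\<close> is the classical smooth function that is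
  flat at 0.\<close>

definition expdec :: "real poly \<Rightarrow> real \<Rightarrow> real" where
  "expdec p t = (if t \<le> 0 then 0 else poly p (1 / t) * exp (- (1 / t)))"

lemma poly_times_exp_minus_tendsto_0:
  "((\<lambda>s. poly p s * exp (- s)) \<longlongrightarrow> 0) (at_top :: real filter)"
proof -
  have "((\<lambda>s. \<Sum>i\<le>degree p. coeff p i * (s ^ i / exp s)) \<longlongrightarrow> (\<Sum>i\<le>degree p. coeff p i * 0)) at_top"
    by (intro tendsto_sum tendsto_mult tendsto_const tendsto_power_div_exp_0)
  moreover have "(\<lambda>s. \<Sum>i\<le>degree p. coeff p i * (s ^ i / exp s)) = (\<lambda>s. poly p s * exp (- s))"
    by (simp add: poly_altdef sum_distrib_right exp_minus divide_inverse mult.assoc fun_eq_iff)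
  ultimately show ?thesis by simp
qed

text \<open>With s = 1/t one has ds/dt = -s^2, so differentiating p(s) exp(-s) gives s^2 (p(s) -
  p'(s)) exp(-s). At t = 0 the right difference quotient is s p(s) exp(-s), which decays as s tends
  to infinity.\<close>

lemma expdec_has_field_derivative:
  "(expdec p has_field_derivative expdec ([:0, 0, 1:] * (p - pderiv p)) t) (at t)"
proof -
  consider "t < 0" | "t > 0" | "t = 0" by linarith
  then show ?thesis
  proof cases
    case 1
    have "((\<lambda>_. 0) has_field_derivative 0) (at t)" by simp
    moreover have "eventually (\<lambda>x. 0 = expdec p x) (nhds t)"
      using eventually_nhds_in_open[of "{..<0}" t] 1
      by (auto simp: expdec_def elim!: eventually_mono)
    ultimately have "(expdec p has_field_derivative 0) (at t)"
      using DERIV_cong_ev[OF refl, of "\<lambda>_. 0" "expdec p" t 0 0] by simp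
    then show ?thesis using 1 by (simp add: expdec_def)
  next
    case 2
    have inv: "((\<lambda>x. 1 / x) has_field_derivative - (1 / t\<^sup>2)) (at t)"
      using 2 by (auto intro!: derivative_eq_intros simp: power2_eq_square)
    have "((\<lambda>x. poly p (1 / x) * exp (- (1 / x))) has_field_derivative
        (poly (pderiv p) (1 / t) * - (1 / t\<^sup>2)) * exp (- (1 / t)) +
        (exp (- (1 / t)) * - (- (1 / t\<^sup>2))) * poly p (1 / t)) (at t)"
      by (intro DERIV_mult DERIV_chain2[OF poly_DERIV inv] DERIV_chain2[OF DERIV_exp] DERIV_minus inv)
    moreover have "(poly (pderiv p) (1 / t) * - (1 / t\<^sup>2)) * exp (- (1 / t)) +
        (exp (- (1 / t)) * - (- (1 / t\<^sup>2))) * poly p (1 / t) = expdec ([:0, 0, 1:] * (p - pderiv p)) t"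
      using 2 by (simp add: expdec_def power2_eq_square algebra_simps)
    ultimately have "((\<lambda>x. poly p (1 / x) * exp (- (1 / x))) has_field_derivative
        expdec ([:0, 0, 1:] * (p - pderiv p)) t) (at t)"
      by simp
    moreover have "eventually (\<lambda>x. poly p (1 / x) * exp (- (1 / x)) = expdec p x) (nhds t)"
      using eventually_nhds_in_open[of "{0<..}" t] 2
      by (auto simp: expdec_def elim!: eventually_mono)
    ultimately show ?thesis
      using DERIV_cong_ev[OF refl] by fast
  next
    case 3
    have "((\<lambda>s. poly (pCons 0 p) s * exp (- s)) \<longlongrightarrow> 0) at_top"
      by (rule poly_times_exp_minus_tendsto_0)
    then have "((\<lambda>h. poly (pCons 0 p) (inverse h) * exp (- inverse h)) \<longlongrightarrow> 0) (at_right 0)"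
      by (rule filterlim_compose) (rule filterlim_inverse_at_top_right)
    then have r: "((\<lambda>h. expdec p h / h) \<longlongrightarrow> 0) (at_right 0)"
      by (rule Lim_transform_eventually)
         (auto simp: eventually_at_right_less expdec_def field_simps eventually_at_filter)
    have l: "((\<lambda>h. expdec p h / h) \<longlongrightarrow> 0) (at_left 0)"
      by (rule tendsto_eventually) (auto simp: eventually_at_filter expdec_def)
    show ?thesis
      using filterlim_split_at[OF l r] 3 by (simp add: DERIV_def expdec_def)
  qed
qed

text \<open>Being closed under partial derivatives makes smoothness of the members immediate.\<close>

inductive bump_alg :: "(real^'n::finite \<Rightarrow> real) \<Rightarrow> bool" where
  const: "bump_alg (\<lambda>x. r)"
| expdec: "bump_alg (\<lambda>x. expdec p (s * x $ i + d))"
| add: "bump_alg f \<Longrightarrow> bump_alg g \<Longrightarrow> bump_alg (\<lambda>x. f x + g x)"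
| mult: "bump_alg f \<Longrightarrow> bump_alg g \<Longrightarrow> bump_alg (\<lambda>x. f x * g x)"

lemma pd_has_field_derivative:
  fixes f :: "real^'n::finite \<Rightarrow> real"
  assumes "f differentiable (at x)"
  shows "((\<lambda>t. f (x + t *\<^sub>R axis i 1)) has_field_derivative pd i f x) (at 0)"
proof -
  have "(\<lambda>t. f (x + t *\<^sub>R axis i 1)) differentiable (at 0)"
    using assms by (intro differentiable_compose[where f = f and g = "\<lambda>t. x + t *\<^sub>R axis i 1"])
      (auto intro!: derivative_intros)
  then show ?thesis
    unfolding pd_def by (simp add: DERIV_deriv_iff_real_differentiable)
qed

lemma pd_eqI:
  "((\<lambda>t. f (x + t *\<^sub>R axis i 1)) has_field_derivative D) (at 0) \<Longrightarrow> pd i f x = D"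
  unfolding pd_def by (rule DERIV_imp_deriv)

text \<open>Induction over the generators: the chain rule turns \<open>expdec p\<close> into a
  multiple of another member of the family, and sums and products follow from linearity and the
  Leibniz rule.\<close>

lemma bump_alg_pd:
  fixes f :: "real^'n::finite \<Rightarrow> real"
  assumes "bump_alg f"
  shows "f differentiable_on UNIV \<and> (\<forall>j. bump_alg (pd j f))"
  using assms
proof induction
  case (const r)
  have "pd j (\<lambda>x. r) = (\<lambda>x::real^'n. 0)" for j
    by (rule ext, rule pd_eqI) simp
  then show ?case using bump_alg.const by simp
next
  case (expdec p s i d)
  let ?q = "[:0, 0, 1:] * (p - pderiv p)"
  have "(expdec p has_derivative (\<lambda>h. expdec ?q t * h)) (at t)" for t
    using expdec_has_field_derivative by (simp only: has_field_derivative_def)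
  then have dd: "expdec p differentiable (at t)" for t
    unfolding differentiable_def by blast
  have 1: "(\<lambda>x::real^'n. expdec p (s * x $ i + d)) differentiable (at x)" for x
  proof -
    have "((\<lambda>x::real^'n. s * x $ i + d) has_derivative (\<lambda>h. s * h $ i)) (at x)"
      by (auto intro!: derivative_eq_intros bounded_linear_imp_has_derivative bounded_linear_vec_nth)
    then have "(\<lambda>x::real^'n. s * x $ i + d) differentiable (at x)"
      unfolding differentiable_def by blast
    then show ?thesis by (rule differentiable_compose[where f = "expdec p", OF dd])
  qed
  have 2: "pd j (\<lambda>x. expdec p (s * x $ i + d)) =
      (\<lambda>x::real^'n. (if i = j then s else 0) * expdec ?q (s * x $ i + d))" for j
  proof (rule ext, rule pd_eqI)
    fix x :: "real^'n"
    have "((\<lambda>t. s * x $ i + d + t * (if i = j then s else 0)) has_field_derivative (if i = j then s else 0)) (at 0)"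
      by (auto intro!: derivative_eq_intros)
    moreover have "(\<lambda>t. s * (x + t *\<^sub>R axis j 1) $ i + d) = (\<lambda>t. s * x $ i + d + t * (if i = j then s else 0))"
      by (auto simp: axis_def algebra_simps)
    ultimately have "((\<lambda>t. s * (x + t *\<^sub>R axis j 1) $ i + d) has_field_derivative (if i = j then s else 0)) (at 0)"
      by (simp only:)
    from DERIV_chain2[OF expdec_has_field_derivative this, of p]
    show "((\<lambda>t. expdec p (s * (x + t *\<^sub>R axis j 1) $ i + d)) has_field_derivative
            (if i = j then s else 0) * expdec ?q (s * x $ i + d)) (at 0)"
      by (simp only: scaleR_zero_left add_0_right mult.commute)
  qed
  show ?case
    unfolding 2 differentiable_on_def
    by (intro conjI allI ballI bump_alg.mult[OF bump_alg.const bump_alg.expdec] 1)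
next
  case (add f g)
  have d: "f differentiable (at x)" "g differentiable (at x)" for x
    using add by (auto simp: differentiable_on_def)
  have "pd j (\<lambda>x. f x + g x) = (\<lambda>x. pd j f x + pd j g x)" for j
    by (rule ext, rule pd_eqI) (intro DERIV_add pd_has_field_derivative d)
  moreover have "bump_alg (\<lambda>x. pd j f x + pd j g x)" for j
    using add by (intro bump_alg.add) auto
  ultimately show ?case using d by (auto simp: differentiable_on_def)
next
  case (mult f g)
  have d: "f differentiable (at x)" "g differentiable (at x)" for x
    using mult by (auto simp: differentiable_on_def)
  have "pd j (\<lambda>x. f x * g x) = (\<lambda>x. pd j f x * g x + pd j g x * f x)" for j
    using DERIV_mult[OF pd_has_field_derivative[OF d(1)] pd_has_field_derivative[OF d(2)]]
    by (intro ext pd_eqI) simp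
  moreover have "bump_alg (\<lambda>x. pd j f x * g x + pd j g x * f x)" for j
    using mult by (intro bump_alg.add bump_alg.mult) auto
  ultimately show ?case using d by (auto simp: differentiable_on_def)
qed

lemma bump_alg_smooth:
  assumes "bump_alg f" shows "smooth f"
proof -
  have "bump_alg (iter_pd is f)" for "is"
    using assms by (induction "is") (auto simp: bump_alg_pd)
  then show ?thesis by (auto simp: smooth_def bump_alg_pd)
qed

section \<open>Test functions adapted to boxes\<close>

lemma bump_alg_prod:
  "finite I \<Longrightarrow> (\<And>i. i \<in> I \<Longrightarrow> bump_alg (f i)) \<Longrightarrow> bump_alg (\<lambda>x. \<Prod>i\<in>I. f i x)"
  by (induction I rule: finite_induct) (auto intro: bump_alg.const bump_alg.mult)

text \<open>One flat factor for each face keeps the product positive exactly on the open box; the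
  scaling by \<open>Suc m\<close> drives the values there up to 1.\<close>

definition box_bump :: "real^'n::finite \<Rightarrow> real^'n \<Rightarrow> nat \<Rightarrow> real^'n \<Rightarrow> real" where
  "box_bump a b m x = (\<Prod>i\<in>UNIV. expdec 1 (real (Suc m) * (x $ i - a $ i)) * expdec 1 (real (Suc m) * (b $ i - x $ i)))"

lemma expdec_1_bounds: "0 \<le> expdec 1 t" "expdec 1 t \<le> 1"
  by (auto simp: expdec_def)

lemma box_bump_bounds: "0 \<le> box_bump a b m x" "box_bump a b m x \<le> 1"
  unfolding box_bump_def
  by (auto intro!: prod_nonneg prod_le_1 mult_nonneg_nonneg mult_le_one simp: expdec_1_bounds)

lemma box_bump_nonzero_iff: "box_bump a b m x \<noteq> 0 \<longleftrightarrow> x \<in> box a b"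
  by (auto simp: box_bump_def mem_box_cart expdec_def zero_less_mult_iff not_le)

lemma box_bump_tendsto: "(\<lambda>m. box_bump a b m x) \<longlonglongrightarrow> indicator (box a b) x"
proof (cases "x \<in> box a b")
  case False
  then have "(\<lambda>m. box_bump a b m x) = (\<lambda>m. 0)" using box_bump_nonzero_iff by blast
  then show ?thesis using False by simp
next
  case True
  have e: "(\<lambda>m. expdec 1 (real (Suc m) * t)) \<longlonglongrightarrow> 1" if "t > 0" for t
  proof -
    have "(\<lambda>m. exp (- (inverse (real (Suc m)) * (1 / t)))) \<longlonglongrightarrow> exp (- (0 * (1 / t)))"
      by (intro tendsto_intros LIMSEQ_inverse_real_of_nat)
    moreover have "(\<lambda>m. exp (- (inverse (real (Suc m)) * (1 / t)))) = (\<lambda>m. expdec 1 (real (Suc m) * t))"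
      using that by (auto simp: expdec_def fun_eq_iff mult_le_0_iff inverse_eq_divide)
    ultimately show ?thesis by simp
  qed
  have "(\<lambda>m. box_bump a b m x) \<longlonglongrightarrow> (\<Prod>i\<in>(UNIV::'a set). 1 * 1)"
    unfolding box_bump_def using True by (intro tendsto_prod tendsto_mult e) (auto simp: mem_box_cart)
  then show ?thesis using True by simp
qed

lemma box_bump_test_fun:
  assumes "cbox a b \<subseteq> \<Omega>"
  shows "test_fun \<Omega> (box_bump a b m)"
proof -
  have "box_bump a b m = (\<lambda>x. \<Prod>i\<in>UNIV. expdec 1 (real (Suc m) * x $ i + (- real (Suc m) * a $ i)) *
            expdec 1 (- real (Suc m) * x $ i + real (Suc m) * b $ i))"
    by (simp add: box_bump_def fun_eq_iff algebra_simps)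
  then have "bump_alg (box_bump a b m)"
    by (simp only:) (intro bump_alg_prod bump_alg.mult bump_alg.expdec finite)
  moreover have "{x. box_bump a b m x \<noteq> 0} = box a b" by (auto simp: box_bump_nonzero_iff)
  moreover have "closure (box a b) \<subseteq> cbox a b" by (intro closure_minimal box_subset_cbox closed_cbox)
  moreover then have "compact (closure (box a b))"
    using bounded_subset[OF bounded_cbox] by (metis bounded_box compact_closure)
  ultimately show ?thesis unfolding test_fun_def using assms bump_alg_smooth by auto
qed

text \<open>Boxes form an intersection-stable generator of the Borel sets, so by Dynkin's argument
  the integral of \<open>f\<close> vanishes over every Borel set, and a Lebesgue set differs from a
  Borel set by a null set. Hence \<open>f\<close> and 0 have the same integral over all measurable
  sets and agree almost everywhere.\<close>

lemma AE_zero_if_box_integrals_zero: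
  fixes f :: "'a::euclidean_space \<Rightarrow> real"
  assumes f: "integrable lebesgue f"
    and box: "\<And>a b. (LINT x:box a b|lebesgue. f x) = 0"
  shows "AE x in lebesgue. f x = 0"
proof -
  have fm[measurable]: "f \<in> borel_measurable lebesgue" using f by simp
  have si: "set_integrable lebesgue A f" if "A \<in> sets lebesgue" for A
    unfolding set_integrable_def using f that by (intro integrable_mult_indicator)
  \<comment> \<open>The integral over the whole space is needed for the complement step; it is the
    limit of the integrals over growing boxes.\<close>
  have UNIV: "(LINT x:UNIV|lebesgue. f x) = 0"
  proof -
    define B where "B n = box (- real n *\<^sub>R One) (real n *\<^sub>R One :: 'a)" for n
    have "(\<lambda>n. LINT x:B n|lebesgue. f x) \<longlonglongrightarrow> (LINT x:(\<Union>n. B n)|lebesgue. f x)"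
    proof (rule set_integral_cont_up)
      show "incseq B" unfolding B_def incseq_def
        by (auto simp: subset_box box_ne_empty)
    qed (auto simp: B_def intro!: si)
    moreover have "(\<Union>n. B n) = UNIV" unfolding B_def using UN_box_eq_UNIV by auto
    ultimately show ?thesis using box by (simp add: B_def LIMSEQ_const_iff)
  qed
  have borel: "(LINT x:A|lebesgue. f x) = 0" if "A \<in> sets borel" for A
  proof -
    have A: "A \<in> sigma_sets UNIV (range (\<lambda>(a, b). box a b :: 'a set))"
      using that unfolding borel_eq_box by simp
    have sub: "sigma_sets UNIV (range (\<lambda>(a, b). box a b :: 'a set)) = sets borel"
      unfolding borel_eq_box by simp
    have stable: "Int_stable (range (\<lambda>(a, b). box a b :: 'a set))"
      by (rule Int_stableI_image) (clarsimp simp: box_Int_box, intro exI, rule refl)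
    show ?thesis
    proof (rule sigma_sets_induct_disjoint[OF stable _ A, where P = "\<lambda>X. (LINT x:X|lebesgue. f x) = 0"])
      show "(LINT x:X|lebesgue. f x) = 0" if "X \<in> range (\<lambda>(a, b). box a b)" for X
        using that box by auto
      show "(LINT x:{}|lebesgue. f x) = 0" by (simp add: set_lebesgue_integral_def)
      show "(LINT x:UNIV - X|lebesgue. f x) = 0"
        if "X \<in> sigma_sets UNIV (range (\<lambda>(a, b). box a b :: 'a set))" "(LINT x:X|lebesgue. f x) = 0" for X
      proof -
        have X: "X \<in> sets lebesgue" "UNIV - X \<in> sets lebesgue" using that(1) unfolding sub by auto
        have "(LINT x:X \<union> (UNIV - X)|lebesgue. f x) = (LINT x:X|lebesgue. f x) + (LINT x:UNIV - X|lebesgue. f x)"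
          by (rule set_integral_Un) (auto intro!: si X)
        moreover have "X \<union> (UNIV - X) = UNIV" by auto
        ultimately show ?thesis using UNIV that(2) by simp
      qed
      show "(LINT x:(\<Union>i. X i)|lebesgue. f x) = 0"
        if X: "disjoint_family X" "range X \<subseteq> sigma_sets UNIV (range (\<lambda>(a, b). box a b :: 'a set))"
          "\<And>i. (LINT x:X i|lebesgue. f x) = 0" for X :: "nat \<Rightarrow> 'a set"
      proof -
        have m: "X i \<in> sets lebesgue" for i using X(2) unfolding sub by auto
        have "(LINT x:(\<Union>i. X i)|lebesgue. f x) = (\<Sum>i. (LINT x:X i|lebesgue. f x))"
          using X(1) by (intro lebesgue_integral_countable_add m si sets.countable_UN)
            (auto simp: disjoint_family_on_def intro: m)
        then show ?thesis using X(3) by simp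
      qed
    qed simp
  qed
  have "AE x in lebesgue. f x = (\<lambda>_. 0) x"
  proof (rule density_unique_real)
    fix A :: "'a set" assume A: "A \<in> sets lebesgue"
    \<comment> \<open>The main part of \<open>A\<close> in the completion is a Borel set that equals
      \<open>A\<close> up to a null set.\<close>
    define S where "S = main_part lborel A"
    have S: "S \<in> sets borel" "AE x in lebesgue. x \<in> S \<longleftrightarrow> x \<in> A"
      using A AE_in_main_part[OF A] main_part_sets[OF A] by (auto simp: S_def AE_completion_iff)
    have "(LINT x:A|lebesgue. f x) = (LINT x:S|lebesgue. f x)"
      proof (rule set_integral_cong_set)
      show "set_borel_measurable lebesgue A f" "set_borel_measurable lebesgue S f"
        using si[of A] si[of S] A S(1) by (auto simp: set_borel_measurable_def set_integrable_def)
    qed (use S(2) in auto)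
    then show "(LINT x:A|lebesgue. f x) = (LINT x:A|lebesgue. 0)" using borel S by simp
  qed (use f in auto)
  then show ?thesis by simp
qed

section \<open>Square integrable functions\<close>

lemma set_integral_eq_mult: "(LINT x:S|M. f x) = (LINT x|M. indicator S x * (f x :: real))"
  by (simp add: set_lebesgue_integral_def)

lemma set_integrable_eq_mult: "set_integrable M S f = integrable M (\<lambda>x. indicator S x * (f x :: real))"
  by (simp add: set_integrable_def)

lemma L2_iff:
  "L2 M S f \<longleftrightarrow> (\<lambda>x. indicator S x * f x) \<in> borel_measurable M \<and>
     integrable M (\<lambda>x. (indicator S x * f x)\<^sup>2)"
proof -
  have "(\<lambda>x. indicator S x * (f x)\<^sup>2) = (\<lambda>x. (indicator S x * f x)\<^sup>2)"
    by (auto simp: indicator_def)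
  then show ?thesis by (simp add: L2_def set_borel_measurable_def set_integrable_def)
qed

lemma L2_norm_eq: "L2_norm M S f = sqrt (LINT x|M. (indicator S x * f x)\<^sup>2)"
  unfolding L2_norm_def set_lebesgue_integral_def
  by (rule arg_cong[of _ _ sqrt], rule Bochner_Integration.integral_cong) (auto simp: indicator_def)

lemma L2_norm_nonneg: "0 \<le> L2_norm M S f"
  unfolding L2_norm_eq by simp

lemma L2_mult_integrable:
  assumes "L2 M S f" "L2 M S g"
  shows "set_integrable M S (\<lambda>x. f x * g x)"
proof -
  let ?F = "\<lambda>x. indicator S x * f x" and ?G = "\<lambda>x. indicator S x * g x"
  have m[measurable]: "?F \<in> borel_measurable M" "?G \<in> borel_measurable M"
    and i: "integrable M (\<lambda>x. (?F x)\<^sup>2)" "integrable M (\<lambda>x. (?G x)\<^sup>2)"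
    using assms by (auto simp: L2_iff)
  have "integrable M (\<lambda>x. ?F x * ?G x)"
  proof (rule Bochner_Integration.integrable_bound[OF Bochner_Integration.integrable_add[OF i]])
    have "\<bar>a * b\<bar> \<le> a\<^sup>2 + b\<^sup>2" for a b :: real
    proof -
      have "2 * (\<bar>a\<bar> * \<bar>b\<bar>) \<le> a\<^sup>2 + b\<^sup>2"
        using sum_squares_bound[of "\<bar>a\<bar>" "\<bar>b\<bar>"] by (simp add: mult.assoc)
      moreover have "0 \<le> \<bar>a\<bar> * \<bar>b\<bar>" by simp
      ultimately have "\<bar>a\<bar> * \<bar>b\<bar> \<le> a\<^sup>2 + b\<^sup>2" by linarith
      then show ?thesis by (simp add: abs_mult)
    qed
    then show "AE x in M. norm (?F x * ?G x) \<le> norm ((?F x)\<^sup>2 + (?G x)\<^sup>2)"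
      by (auto simp: abs_of_nonneg)
  qed measurable
  moreover have "(\<lambda>x. ?F x * ?G x) = (\<lambda>x. indicator S x * (f x * g x))"
    by (auto simp: indicator_def)
  ultimately show ?thesis by (simp add: set_integrable_eq_mult)
qed

lemma L2_lincomb:
  assumes "L2 M S f" "L2 M S g"
  shows "L2 M S (\<lambda>x. s * f x + t * g x)"
proof -
  let ?F = "\<lambda>x. indicator S x * f x" and ?G = "\<lambda>x. indicator S x * g x"
  have m[measurable]: "?F \<in> borel_measurable M" "?G \<in> borel_measurable M"
    and i: "integrable M (\<lambda>x. (?F x)\<^sup>2)" "integrable M (\<lambda>x. (?G x)\<^sup>2)"
    using assms by (auto simp: L2_iff)
  have fg: "integrable M (\<lambda>x. indicator S x * (f x * g x))"
    using L2_mult_integrable[OF assms] by (simp add: set_integrable_eq_mult)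
  have "(\<lambda>x. s * ?F x + t * ?G x) \<in> borel_measurable M" by measurable
  moreover have "(\<lambda>x. s * ?F x + t * ?G x) = (\<lambda>x. indicator S x * (s * f x + t * g x))"
    by (auto simp: algebra_simps)
  moreover have "integrable M (\<lambda>x. s\<^sup>2 * (?F x)\<^sup>2 + t\<^sup>2 * (?G x)\<^sup>2 + 2 * s * t * (indicator S x * (f x * g x)))"
    using i fg by auto
  moreover have "(\<lambda>x. s\<^sup>2 * (?F x)\<^sup>2 + t\<^sup>2 * (?G x)\<^sup>2 + 2 * s * t * (indicator S x * (f x * g x)))
      = (\<lambda>x. (indicator S x * (s * f x + t * g x))\<^sup>2)"
    by (rule ext) (auto simp: indicator_def power2_eq_square algebra_simps)
  ultimately show ?thesis unfolding L2_iff by simp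
qed

lemma L2_diff: "L2 M S f \<Longrightarrow> L2 M S g \<Longrightarrow> L2 M S (\<lambda>x. f x - g x)"
  using L2_lincomb[of M S f g 1 "-1"] by simp

lemma L2_add: "L2 M S f \<Longrightarrow> L2 M S g \<Longrightarrow> L2 M S (\<lambda>x. f x + g x)"
  using L2_lincomb[of M S f g 1 1] by simp

lemma L2_cmult: "L2 M S f \<Longrightarrow> L2 M S (\<lambda>x. s * f x)"
  using L2_lincomb[of M S f f s 0] by simp

lemma L2_zero: "L2 M S (\<lambda>x. 0)"
  by (simp add: L2_iff)

lemma L2_sum: "(\<And>i. i \<in> I \<Longrightarrow> L2 M S (f i)) \<Longrightarrow> L2 M S (\<lambda>x. \<Sum>i\<in>I. f i x)"
  by (induction I rule: infinite_finite_induct) (auto intro: L2_add L2_zero)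

lemma L2_Linf_mult:
  assumes "Linf M S k" "L2 M S f"
  shows "L2 M S (\<lambda>x. k x * f x)"
proof -
  let ?F = "\<lambda>x. indicator S x * f x" and ?K = "\<lambda>x. indicator S x * k x"
  obtain B where B: "AE x in M. x \<in> S \<longrightarrow> \<bar>k x\<bar> \<le> B" using assms by (auto simp: Linf_def)
  have m[measurable]: "?F \<in> borel_measurable M" "?K \<in> borel_measurable M"
    and i: "integrable M (\<lambda>x. (?F x)\<^sup>2)"
    using assms by (auto simp: L2_iff Linf_def set_borel_measurable_def)
  have e: "?K x * ?F x = indicator S x * (k x * f x)" for x by (auto simp: indicator_def)
  have "(\<lambda>x. ?K x * ?F x) \<in> borel_measurable M" by measurable
  moreover have "integrable M (\<lambda>x. (?K x * ?F x)\<^sup>2)"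
  proof (rule Bochner_Integration.integrable_bound[of M "\<lambda>x. B\<^sup>2 * (?F x)\<^sup>2"])
    show "AE x in M. norm ((?K x * ?F x)\<^sup>2) \<le> norm (B\<^sup>2 * (?F x)\<^sup>2)"
      using B
    proof eventually_elim
      case (elim x)
      have "(k x)\<^sup>2 \<le> B\<^sup>2" if "x \<in> S"
        using power_mono[of "\<bar>k x\<bar>" B 2] elim that by simp
      then show ?case by (auto simp: indicator_def power_mult_distrib intro!: mult_right_mono)
    qed
  qed (use i in auto)
  ultimately show ?thesis unfolding L2_iff e by blast
qed

lemma set_integrable_sumI:
  fixes f :: "'i \<Rightarrow> 'a \<Rightarrow> real"
  shows "(\<And>i. i \<in> I \<Longrightarrow> set_integrable M S (f i)) \<Longrightarrow> set_integrable M S (\<lambda>x. \<Sum>i\<in>I. f i x)"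
  by (simp add: set_integrable_def sum_distrib_left)

text \<open>Integrating the quadratic in t gives F + 2 t H + t^2 G \<ge> 0 for all t, and the
  discriminant yields H^2 \<le> F G. Keeping \<open>f\<close>, \<open>g\<close>, \<open>h\<close>
  abstract serves both the scalar product of functions and the quadratic form of a matrix
  field.\<close>

lemma set_integral_quadratic_Cauchy_Schwarz:
  fixes f g h :: "'a \<Rightarrow> real"
  assumes i: "set_integrable M S f" "set_integrable M S g" "set_integrable M S h"
    and nn: "AE x in M. x \<in> S \<longrightarrow> (\<forall>t. 0 \<le> f x + 2 * t * h x + t\<^sup>2 * g x)"
  shows "\<bar>LINT x:S|M. h x\<bar> \<le> sqrt (LINT x:S|M. f x) * sqrt (LINT x:S|M. g x)"
proof -
  define F G H where "F = (LINT x:S|M. f x)" "G = (LINT x:S|M. g x)" "H = (LINT x:S|M. h x)"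
  note FGH = this
  have q: "0 \<le> F + 2 * t * H + t\<^sup>2 * G" for t
  proof -
    have "0 \<le> (LINT x:S|M. f x + 2 * t * h x + t\<^sup>2 * g x)"
      unfolding set_integral_eq_mult
      by (rule integral_nonneg_AE) (use nn in eventually_elim, auto simp: indicator_def)
    also have "\<dots> = F + 2 * t * H + t\<^sup>2 * G"
      unfolding FGH using i by simp
    finally show ?thesis .
  qed
  have F: "0 \<le> F" using q[of 0] by simp
  have "H\<^sup>2 \<le> F * G \<and> 0 \<le> G"
  proof (cases "G = 0")
    case True
    have "H = 0"
    proof (rule ccontr)
      assume "H \<noteq> 0"
      \<comment> \<open>For G = 0 the quadratic is affine in t; this t is the point where it takes
        the value -1.\<close>
      then have "F + 2 * (- (F + 1) / (2 * H)) * H = -1" by (simp add: field_simps)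
      then show False using q[of "- (F + 1) / (2 * H)"] True by simp
    qed
    then show ?thesis using True by simp
  next
    case False
    have G: "G > 0"
    proof (rule ccontr)
      assume "\<not> G > 0"
      then have "G < 0" using False by simp
      \<comment> \<open>If G were negative, the quadratic would become negative for large t: this t
        is at least 1 and satisfies t (-G) > F + 2 |H|.\<close>
      define t where "t = (F + 2 * \<bar>H\<bar> + 1) / (- G) + 1"
      have t1: "t \<ge> 1" using F \<open>G < 0\<close> by (simp add: t_def divide_nonneg_neg)
      have "t * (- G) = F + 2 * \<bar>H\<bar> + 1 - G" using \<open>G < 0\<close> by (simp add: t_def field_simps)
      then have "t * (- G) > F + 2 * \<bar>H\<bar>" using \<open>G < 0\<close> by simp
      then have "t * (t * (- G)) > t * (F + 2 * \<bar>H\<bar>)" using t1 by (intro mult_strict_left_mono) auto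
      moreover have "t * F \<ge> F" using t1 F mult_right_mono[of 1 t F] by simp
      moreover have "t * H \<le> t * \<bar>H\<bar>" using t1 by (intro mult_left_mono) auto
      moreover have "t * (F + 2 * \<bar>H\<bar>) = t * F + 2 * (t * \<bar>H\<bar>)" by (simp add: algebra_simps)
      ultimately have "F + 2 * (t * H) + t * (t * G) < 0" by simp
      then show False using q[of t] by (simp add: power2_eq_square algebra_simps)
    qed
    \<comment> \<open>The minimiser of the quadratic is t = -H/G.\<close>
    have "F + 2 * (- H / G) * H + (- H / G)\<^sup>2 * G = F - H\<^sup>2 / G"
      using G by (simp add: field_simps power2_eq_square)
    then have "H\<^sup>2 / G \<le> F" using q[of "- H / G"] by simp
    then show ?thesis using G by (simp add: field_simps)
  qed
  then have "sqrt (H\<^sup>2) \<le> sqrt (F * G)" by (intro real_sqrt_le_mono) auto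
  then show ?thesis unfolding FGH[symmetric] by (simp add: real_sqrt_mult)
qed

lemma L2_Cauchy_Schwarz:
  assumes "L2 M S f" "L2 M S g"
  shows "\<bar>LINT x:S|M. f x * g x\<bar> \<le> L2_norm M S f * L2_norm M S g"
  unfolding L2_norm_def
proof (rule set_integral_quadratic_Cauchy_Schwarz)
  show "AE x in M. x \<in> S \<longrightarrow> (\<forall>t. 0 \<le> (f x)\<^sup>2 + 2 * t * (f x * g x) + t\<^sup>2 * (g x)\<^sup>2)"
  proof (intro AE_I2 impI allI)
    fix x t
    have "(f x)\<^sup>2 + 2 * t * (f x * g x) + t\<^sup>2 * (g x)\<^sup>2 = (f x + t * g x)\<^sup>2"
      by (simp add: power2_eq_square algebra_simps)
    then show "0 \<le> (f x)\<^sup>2 + 2 * t * (f x * g x) + t\<^sup>2 * (g x)\<^sup>2" by simp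
  qed
qed (use assms L2_mult_integrable[OF assms] in \<open>auto simp: L2_def\<close>)

text \<open>Minkowski's inequality, proved after squaring: Cauchy-Schwarz bounds the mixed
  term.\<close>

lemma L2_norm_lincomb_le:
  assumes "L2 M S f" "L2 M S g"
  shows "L2_norm M S (\<lambda>x. s * f x + t * g x) \<le> \<bar>s\<bar> * L2_norm M S f + \<bar>t\<bar> * L2_norm M S g"
proof (rule power2_le_imp_le)
  have i: "set_integrable M S (\<lambda>x. (f x)\<^sup>2)" "set_integrable M S (\<lambda>x. (g x)\<^sup>2)"
     "set_integrable M S (\<lambda>x. f x * g x)"
    using assms L2_mult_integrable[OF assms] by (auto simp: L2_def)
  have sq: "(L2_norm M S k)\<^sup>2 = (LINT x:S|M. (k x)\<^sup>2)" for k
    unfolding L2_norm_def set_integral_eq_mult by simp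
  have "(L2_norm M S (\<lambda>x. s * f x + t * g x))\<^sup>2
      = (LINT x:S|M. s\<^sup>2 * (f x)\<^sup>2 + t\<^sup>2 * (g x)\<^sup>2 + 2 * s * t * (f x * g x))"
    unfolding sq by (rule arg_cong[of _ _ "set_lebesgue_integral M S"])
      (auto simp: power2_eq_square algebra_simps)
  also have "\<dots> = s\<^sup>2 * (LINT x:S|M. (f x)\<^sup>2) + t\<^sup>2 * (LINT x:S|M. (g x)\<^sup>2) + 2 * s * t * (LINT x:S|M. f x * g x)"
    using i by simp
  also have "\<dots> \<le> s\<^sup>2 * (L2_norm M S f)\<^sup>2 + t\<^sup>2 * (L2_norm M S g)\<^sup>2 + 2 * \<bar>s\<bar> * \<bar>t\<bar> * (L2_norm M S f * L2_norm M S g)"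
  proof -
    have "s * t * (LINT x:S|M. f x * g x) \<le> \<bar>s * t\<bar> * \<bar>LINT x:S|M. f x * g x\<bar>"
      by (metis abs_ge_self abs_mult)
    also have "\<dots> \<le> \<bar>s * t\<bar> * (L2_norm M S f * L2_norm M S g)"
      by (intro mult_left_mono L2_Cauchy_Schwarz assms) auto
    finally show ?thesis unfolding sq by (simp add: abs_mult)
  qed
  also have "\<dots> = (\<bar>s\<bar> * L2_norm M S f + \<bar>t\<bar> * L2_norm M S g)\<^sup>2"
    by (simp add: power2_sum power_mult_distrib)
  finally show "(L2_norm M S (\<lambda>x. s * f x + t * g x))\<^sup>2 \<le> (\<bar>s\<bar> * L2_norm M S f + \<bar>t\<bar> * L2_norm M S g)\<^sup>2" .
qed (simp add: L2_norm_nonneg)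

lemma L2_norm_lincomb_tendsto_0:
  assumes "\<And>k. L2 M S (f k)" "\<And>k. L2 M S (g k)"
    and "(\<lambda>k. L2_norm M S (f k)) \<longlonglongrightarrow> 0" "(\<lambda>k. L2_norm M S (g k)) \<longlonglongrightarrow> 0"
  shows "(\<lambda>k. L2_norm M S (\<lambda>x. s * f k x + t * g k x)) \<longlonglongrightarrow> 0"
proof (rule tendsto_sandwich[of "\<lambda>_. 0"])
  show "(\<lambda>k. \<bar>s\<bar> * L2_norm M S (f k) + \<bar>t\<bar> * L2_norm M S (g k)) \<longlonglongrightarrow> 0"
    using tendsto_add[OF tendsto_mult[OF tendsto_const[of "\<bar>s\<bar>"] assms(3)]
        tendsto_mult[OF tendsto_const[of "\<bar>t\<bar>"] assms(4)]] by simp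
  show "\<forall>\<^sub>F k in sequentially. 0 \<le> L2_norm M S (\<lambda>x. s * f k x + t * g k x)"
    by (intro always_eventually allI L2_norm_nonneg)
  show "\<forall>\<^sub>F k in sequentially. L2_norm M S (\<lambda>x. s * f k x + t * g k x)
      \<le> \<bar>s\<bar> * L2_norm M S (f k) + \<bar>t\<bar> * L2_norm M S (g k)"
    by (intro always_eventually allI L2_norm_lincomb_le assms(1,2))
qed simp

text \<open>Since the Lebesgue measure is complete, the two integrands, extended by 0, are both
  measurable or both not measurable; in the second case both integrals have the default value
  0.\<close>

lemma set_integral_lebesgue_cong_AE:
  fixes f g :: "'a::euclidean_space \<Rightarrow> real"
  assumes "AE x in lebesgue. x \<in> S \<longrightarrow> f x = g x"
  shows "(LINT x:S|lebesgue. f x) = (LINT x:S|lebesgue. g x)"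
proof -
  let ?F = "\<lambda>x. indicator S x * f x" and ?G = "\<lambda>x. indicator S x * g x"
  have e: "AE x in lebesgue. ?F x = ?G x"
    using assms by eventually_elim (auto simp: indicator_def)
  then have e': "AE x in lebesgue. ?G x = ?F x" by (rule AE_symmetric)
  show ?thesis
  proof (cases "?F \<in> borel_measurable lebesgue")
    case True
    moreover have "?G \<in> borel_measurable lebesgue" by (rule borel_measurable_AE[OF True e])
    ultimately show ?thesis unfolding set_integral_eq_mult using e by (rule integral_cong_AE)
  next
    case False
    then have "?G \<notin> borel_measurable lebesgue" using borel_measurable_AE[OF _ e'] by metis
    then have "\<not> integrable lebesgue ?F" "\<not> integrable lebesgue ?G"
      using False borel_measurable_integrable by metis+
    then show ?thesis unfolding set_integral_eq_mult by (simp add: not_integrable_integral_eq)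
  qed
qed

lemma L2_norm_lebesgue_cong_AE:
  fixes f g :: "'a::euclidean_space \<Rightarrow> real"
  assumes "AE x in lebesgue. x \<in> S \<longrightarrow> f x = g x"
  shows "L2_norm lebesgue S f = L2_norm lebesgue S g"
  unfolding L2_norm_def
  by (rule arg_cong[of _ _ sqrt], rule set_integral_lebesgue_cong_AE) (use assms in eventually_elim, auto)

text \<open>The function is bounded on the compact closure of \<Omega>, and \<Omega> has finite
  measure.\<close>

lemma L2_continuous_bounded_open:
  fixes f :: "'a::euclidean_space \<Rightarrow> real"
  assumes "continuous_on UNIV f" "open \<Omega>" "bounded \<Omega>"
  shows "L2 lebesgue \<Omega> f"
proof -
  have m: "f \<in> borel_measurable borel" using assms by (intro borel_measurable_continuous_onI)
  have f[measurable]: "f \<in> borel_measurable lebesgue"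
    using measurable_completion[of f lborel borel] m by simp
  have O[measurable]: "\<Omega> \<in> sets lebesgue" using assms by auto
  have "compact (closure \<Omega>)" using assms by simp
  then have "bounded (f ` closure \<Omega>)"
    using assms continuous_on_subset by (intro compact_imp_bounded compact_continuous_image) auto
  then obtain B where B: "\<And>x. x \<in> closure \<Omega> \<Longrightarrow> \<bar>f x\<bar> \<le> B"
    unfolding bounded_iff by auto
  have fin: "emeasure lebesgue \<Omega> < \<infinity>" using emeasure_bounded_finite[OF assms(3)] assms(2) by simp
  have "integrable lebesgue (\<lambda>x. (indicator \<Omega> x * f x)\<^sup>2)"
  proof (rule Bochner_Integration.integrable_bound[of _ "\<lambda>x. B\<^sup>2 * indicator \<Omega> x"])
    show "integrable lebesgue (\<lambda>x. B\<^sup>2 * indicator \<Omega> x :: real)"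
      using fin by (intro integrable_mult_right integrable_real_indicator) auto
    show "AE x in lebesgue. norm ((indicator \<Omega> x * f x)\<^sup>2) \<le> norm (B\<^sup>2 * indicator \<Omega> x)"
    proof (rule AE_I2)
      fix x
      have "(f x)\<^sup>2 \<le> B\<^sup>2" if "x \<in> \<Omega>"
        using power_mono[of "\<bar>f x\<bar>" B 2] B[of x] that closure_subset[of \<Omega>] by auto
      then show "norm ((indicator \<Omega> x * f x)\<^sup>2) \<le> norm (B\<^sup>2 * indicator \<Omega> x)"
        by (auto simp: indicator_def)
    qed
  qed measurable
  then show ?thesis by (simp add: L2_iff)
qed

section \<open>Smooth functions and the fundamental lemma of the calculus of variations\<close>

lemma smooth_differentiable: "smooth f \<Longrightarrow> f differentiable_on UNIV"
  unfolding smooth_def by (drule spec[of _ "[]"]) simp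

lemma smooth_pd: "smooth f \<Longrightarrow> smooth (pd i f)"
  unfolding smooth_def
proof
  fix js assume f: "\<forall>is. iter_pd is f differentiable_on UNIV"
  \<comment> \<open>The last entry of the list is the derivative that is applied first.\<close>
  have "iter_pd (js @ [i]) f = iter_pd js (pd i f)" by (induction js) (simp_all only: append.simps iter_pd.simps)
  then show "iter_pd js (pd i f) differentiable_on UNIV" using spec[OF f, of "js @ [i]"] by (simp only:)
qed

text \<open>Box bumps are admissible tests and converge boundedly to indicators of boxes. So
  \<open>h\<close> has zero integral over every box whose closure lies in \<Omega>, vanishes almost
  everywhere on each of them, and countably many of them cover \<Omega>.\<close>

lemma fundamental_lemma_calculus_of_variations:
  fixes h :: "real^'n::finite \<Rightarrow> real"
  assumes O: "open \<Omega>" "bounded \<Omega>" and h: "L2 lebesgue \<Omega> h"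
    and test: "\<And>\<phi>. test_fun \<Omega> \<phi> \<Longrightarrow> (LINT x:\<Omega>|lebesgue. h x * \<phi> x) = 0"
  shows "AE x in lebesgue. x \<in> \<Omega> \<longrightarrow> h x = 0"
proof -
  define f where "f x = indicator \<Omega> x * h x" for x
  \<comment> \<open>The constant 1 is square integrable on the bounded set \<Omega>, so
    \<open>h\<close> itself is integrable there.\<close>
  have "set_integrable lebesgue \<Omega> (\<lambda>x. h x * 1)"
    by (rule L2_mult_integrable[OF h L2_continuous_bounded_open[OF continuous_on_const O]])
  moreover have "(\<lambda>x. indicat_real \<Omega> x *\<^sub>R (h x * 1)) = f" by (rule ext) (simp add: f_def)
  ultimately have f: "integrable lebesgue f" unfolding set_integrable_def by (simp only:)
  have bump: "(LINT x:box a b|lebesgue. f x) = 0" if "cbox a b \<subseteq> \<Omega>" for a b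
  proof -
    have fm: "f \<in> borel_measurable lebesgue" using f by (rule borel_measurable_integrable)
    have bm: "box_bump a b m \<in> borel_measurable lebesgue" for m
    proof -
      have "box_bump a b m differentiable_on UNIV"
        using box_bump_test_fun[OF that] smooth_differentiable by (auto simp: test_fun_def)
      then have "continuous_on UNIV (box_bump a b m)" by (rule differentiable_imp_continuous_on)
      then have "box_bump a b m \<in> borel_measurable borel" by (rule borel_measurable_continuous_onI)
      then have "box_bump a b m \<in> borel_measurable lborel" by simp
      then show ?thesis by (rule measurable_completion)
    qed
    \<comment> \<open>Dominated convergence with majorant |f|, since the bumps take values between 0
      and 1.\<close>
    have "(\<lambda>m. LINT x|lebesgue. f x * box_bump a b m x) \<longlonglongrightarrow> (LINT x|lebesgue. f x * indicator (box a b) x)"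
    proof (rule integral_dominated_convergence)
      show "(\<lambda>x. f x * box_bump a b m x) \<in> borel_measurable lebesgue" for m
        by (rule borel_measurable_times[OF fm bm])
      show "(\<lambda>x. f x * indicator (box a b) x) \<in> borel_measurable lebesgue"
        by (rule borel_measurable_times[OF fm borel_measurable_indicator]) simp
      show "integrable lebesgue (\<lambda>x. \<bar>f x\<bar>)" using f by (rule integrable_abs)
      show "AE x in lebesgue. (\<lambda>m. f x * box_bump a b m x) \<longlonglongrightarrow> f x * indicator (box a b) x"
        by (intro AE_I2 tendsto_mult tendsto_const box_bump_tendsto)
      have le: "\<bar>box_bump a b m x\<bar> \<le> 1" for m x using box_bump_bounds[of a b m x] by simp
      show "AE x in lebesgue. norm (f x * box_bump a b m x) \<le> \<bar>f x\<bar>" for m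
        using mult_left_le[OF le abs_ge_zero] by (intro AE_I2) (simp only: real_norm_def abs_mult)
    qed
    moreover have "(LINT x|lebesgue. f x * box_bump a b m x) = 0" for m
      using test[OF box_bump_test_fun[OF that]] unfolding f_def set_integral_eq_mult by (simp only: mult.assoc)
    ultimately have "(\<lambda>m. 0) \<longlonglongrightarrow> (LINT x|lebesgue. f x * indicator (box a b) x)" by (simp only:)
    then have "(LINT x|lebesgue. f x * indicator (box a b) x) = 0"
      by (rule LIMSEQ_unique[OF _ tendsto_const])
    then show ?thesis unfolding set_integral_eq_mult by (simp only: mult.commute)
  qed
  have zero: "AE x in lebesgue. x \<in> cbox a b \<longrightarrow> f x = 0" if "cbox a b \<subseteq> \<Omega>" for a b
  proof -
    \<comment> \<open>After restriction to \<open>box a b\<close> the integral over any box is an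
      integral over an intersection of two boxes, which is a box with closure inside \<Omega> or
      empty.\<close>
    have "AE x in lebesgue. indicator (box a b) x * f x = 0"
    proof (rule AE_zero_if_box_integrals_zero)
      show "integrable lebesgue (\<lambda>x. indicator (box a b) x * f x)"
        using integrable_mult_indicator[OF _ f, of "box a b"] by simp
      show "(LINT x:box c d|lebesgue. indicator (box a b) x * f x) = 0" for c d
      proof -
        obtain c' d' where cd: "box c d \<inter> box a b = box c' d'" using box_Int_box[of c d a b] by blast
        show ?thesis
        proof (cases "box c' d' = {}")
          case True
          then have "(\<lambda>x. indicator (box c d) x * (indicator (box a b) x * f x)) = (\<lambda>x. 0)"
            using cd by (auto simp: indicator_def fun_eq_iff)
          then show ?thesis by (simp add: set_integral_eq_mult)
        next
          case False
          \<comment> \<open>Only a nonempty open box has \<open>cbox c' d'\<close> as its closure;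
            hence the separate treatment of the empty case.\<close>
          have "cbox c' d' \<subseteq> \<Omega>"
            using False closure_mono[of "box c' d'" "box a b"] cd that
            by (metis Int_lower2 bot.extremum_uniqueI closure_box order_trans)
          moreover have "(\<lambda>x. indicator (box c d) x * (indicator (box a b) x * f x)) = (\<lambda>x. indicator (box c' d') x * f x)"
            unfolding cd[symmetric] by (auto simp: indicator_def fun_eq_iff)
          ultimately show ?thesis using bump[of c' d'] by (simp add: set_integral_eq_mult)
        qed
      qed
    qed
    \<comment> \<open>The faces of a box are negligible, which permits the passage to closed boxes,
      the ones used in the countable cover.\<close>
    moreover have "AE x in lebesgue. x \<notin> cbox a b - box a b"
      by (rule AE_not_in) (metis negligible_frontier_interval negligible_iff_null_sets)
    ultimately show ?thesis by eventually_elim (auto simp: indicator_def)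
  qed
  obtain \<D> where D: "countable \<D>" "\<D> \<subseteq> Pow \<Omega>" "\<And>X. X \<in> \<D> \<Longrightarrow> \<exists>a b. X = cbox a b" "\<Union>\<D> = \<Omega>"
    using open_countable_Union_open_cbox[OF O(1)] by metis
  have "AE x in lebesgue. \<forall>X\<in>\<D>. x \<in> X \<longrightarrow> f x = 0"
    using zero D by (subst AE_ball_countable[OF D(1)]) (metis PowD subsetD)
  then show ?thesis
  proof eventually_elim
    case (elim x)
    show ?case
    proof
      assume x: "x \<in> \<Omega>"
      then obtain X where "X \<in> \<D>" "x \<in> X" using D(4) by blast
      then have "f x = 0" using elim by blast
      then show "h x = 0" using x by (simp add: f_def)
    qed
  qed
qed

section \<open>Weak gradients and traces\<close>

lemma iter_pd_lincomb:
  assumes "smooth f" "smooth g"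
  shows "iter_pd is (\<lambda>x. s * f x + t * g x) = (\<lambda>x. s * iter_pd is f x + t * iter_pd is g x)"
proof (induction "is")
  case Nil
  then show ?case by simp
next
  case (Cons i "is")
  have d: "iter_pd is f differentiable (at x)" "iter_pd is g differentiable (at x)" for x
    using assms by (auto simp: smooth_def differentiable_on_def)
  have "pd i (\<lambda>x. s * iter_pd is f x + t * iter_pd is g x)
      = (\<lambda>x. s * pd i (iter_pd is f) x + t * pd i (iter_pd is g) x)"
    by (intro ext pd_eqI DERIV_add DERIV_cmult pd_has_field_derivative d)
  then show ?case by (simp only: iter_pd.simps Cons)
qed

lemma smooth_lincomb:
  assumes "smooth f" "smooth g"
  shows "smooth (\<lambda>x. s * f x + t * g x)"
  unfolding smooth_def
proof
  fix "is"
  have "(\<lambda>x. s * iter_pd is f x + t * iter_pd is g x) differentiable_on UNIV"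
    using assms unfolding smooth_def
    by (intro differentiable_on_add differentiable_on_mult differentiable_on_const) blast+
  then show "iter_pd is (\<lambda>x. s * f x + t * g x) differentiable_on UNIV"
    by (simp only: iter_pd_lincomb[OF assms])
qed

lemma pd_lincomb:
  "smooth f \<Longrightarrow> smooth g \<Longrightarrow> pd i (\<lambda>x. s * f x + t * g x) = (\<lambda>x. s * pd i f x + t * pd i g x)"
  using iter_pd_lincomb[of f g "[i]" s t] by simp

lemma cgrad_lincomb:
  "smooth f \<Longrightarrow> smooth g \<Longrightarrow> cgrad (\<lambda>x. s * f x + t * g x) x $ i = s * cgrad f x $ i + t * cgrad g x $ i"
  by (simp add: cgrad_def pd_lincomb)

lemma smooth_L2:
  assumes "smooth f" "open \<Omega>" "bounded \<Omega>"
  shows "L2 lebesgue \<Omega> f"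
  by (intro L2_continuous_bounded_open differentiable_imp_continuous_on smooth_differentiable assms)

lemma smooth_L2_cgrad:
  assumes "smooth f" "open \<Omega>" "bounded \<Omega>"
  shows "L2 lebesgue \<Omega> (\<lambda>x. cgrad f x $ i)"
  using smooth_L2[OF smooth_pd[OF assms(1)] assms(2,3)] by (simp add: cgrad_def)

text \<open>Square integrability makes every product with a test function or its derivative
  integrable, so that the integrals split.\<close>

lemma weak_grad_lincomb:
  fixes \<Omega> :: "(real^'n::finite) set"
  assumes O: "open \<Omega>" "bounded \<Omega>"
    and u: "L2 lebesgue \<Omega> u" "\<And>i. L2 lebesgue \<Omega> (\<lambda>x. G x $ i)" "weak_grad \<Omega> u G"
    and v: "L2 lebesgue \<Omega> v" "\<And>i. L2 lebesgue \<Omega> (\<lambda>x. H x $ i)" "weak_grad \<Omega> v H"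
  shows "weak_grad \<Omega> (\<lambda>x. s * u x + t * v x) (\<lambda>x. s *\<^sub>R G x + t *\<^sub>R H x)"
  unfolding weak_grad_def
proof (intro allI impI)
  fix \<phi> i assume \<phi>: "test_fun \<Omega> \<phi>"
  then have sm: "smooth \<phi>" by (simp add: test_fun_def)
  have L: "L2 lebesgue \<Omega> \<phi>" "L2 lebesgue \<Omega> (pd i \<phi>)"
    by (intro smooth_L2 smooth_pd sm O)+
  have "(LINT x:\<Omega>|lebesgue. (s * u x + t * v x) * pd i \<phi> x)
      = (LINT x:\<Omega>|lebesgue. s * (u x * pd i \<phi> x) + t * (v x * pd i \<phi> x))"
    by (simp add: algebra_simps)
  also have "\<dots> = s * (LINT x:\<Omega>|lebesgue. u x * pd i \<phi> x) + t * (LINT x:\<Omega>|lebesgue. v x * pd i \<phi> x)"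
    using L2_mult_integrable[OF u(1) L(2)] L2_mult_integrable[OF v(1) L(2)] by simp
  also have "\<dots> = - (s * (LINT x:\<Omega>|lebesgue. G x $ i * \<phi> x) + t * (LINT x:\<Omega>|lebesgue. H x $ i * \<phi> x))"
    using u(3) v(3) \<phi> by (simp add: weak_grad_def)
  also have "s * (LINT x:\<Omega>|lebesgue. G x $ i * \<phi> x) + t * (LINT x:\<Omega>|lebesgue. H x $ i * \<phi> x)
      = (LINT x:\<Omega>|lebesgue. s * (G x $ i * \<phi> x) + t * (H x $ i * \<phi> x))"
    using L2_mult_integrable[OF u(2)[of i] L(1)] L2_mult_integrable[OF v(2)[of i] L(1)] by simp
  also have "\<dots> = (LINT x:\<Omega>|lebesgue. (s *\<^sub>R G x + t *\<^sub>R H x) $ i * \<phi> x)"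
    by (simp add: algebra_simps)
  finally show "(LINT x:\<Omega>|lebesgue. (s * u x + t * v x) * pd i \<phi> x)
      = - (LINT x:\<Omega>|lebesgue. (s *\<^sub>R G x + t *\<^sub>R H x) $ i * \<phi> x)" .
qed

text \<open>Each component of the difference integrates to 0 against all test functions, so the
  fundamental lemma applies.\<close>

lemma weak_grad_unique:
  fixes \<Omega> :: "(real^'n::finite) set"
  assumes O: "open \<Omega>" "bounded \<Omega>"
    and G: "\<And>i. L2 lebesgue \<Omega> (\<lambda>x. G x $ i)" "weak_grad \<Omega> u G"
    and H: "\<And>i. L2 lebesgue \<Omega> (\<lambda>x. H x $ i)" "weak_grad \<Omega> u H"
  shows "AE x in lebesgue. x \<in> \<Omega> \<longrightarrow> G x = H x"
proof -
  have "AE x in lebesgue. x \<in> \<Omega> \<longrightarrow> G x $ i - H x $ i = 0" for i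
  proof (rule fundamental_lemma_calculus_of_variations[OF O L2_diff[OF G(1) H(1)]])
    fix \<phi> assume \<phi>: "test_fun \<Omega> \<phi>"
    then have L: "L2 lebesgue \<Omega> \<phi>" by (intro smooth_L2 O) (simp add: test_fun_def)
    have "(LINT x:\<Omega>|lebesgue. G x $ i * \<phi> x) = (LINT x:\<Omega>|lebesgue. H x $ i * \<phi> x)"
      using G(2) H(2) \<phi> unfolding weak_grad_def by fastforce
    then show "(LINT x:\<Omega>|lebesgue. (G x $ i - H x $ i) * \<phi> x) = 0"
      using L2_mult_integrable[OF G(1)[of i] L] L2_mult_integrable[OF H(1)[of i] L]
      by (simp add: left_diff_distrib)
  qed
  then have "AE x in lebesgue. \<forall>i. x \<in> \<Omega> \<longrightarrow> G x $ i - H x $ i = 0"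
    by (simp only: AE_all_countable) blast
  then show ?thesis by eventually_elim (auto simp: vec_eq_iff)
qed

lemma H1_grad:
  assumes "H1 \<Omega> v"
  shows "L2 lebesgue \<Omega> (\<lambda>x. grad \<Omega> v x $ i)" "weak_grad \<Omega> v (grad \<Omega> v)"
proof -
  have "\<exists>G. (\<forall>i. L2 lebesgue \<Omega> (\<lambda>x. G x $ i)) \<and> weak_grad \<Omega> v G"
    using assms by (simp add: H1_def)
  from someI_ex[OF this]
  show "L2 lebesgue \<Omega> (\<lambda>x. grad \<Omega> v x $ i)" "weak_grad \<Omega> v (grad \<Omega> v)"
    unfolding grad_def by blast+
qed

text \<open>The combination of the gradients is a weak gradient of the combination. As
  \<open>grad\<close> is an arbitrary choice among weak gradients, uniqueness identifies the two
  almost everywhere only.\<close>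

lemma H1_lincomb:
  assumes O: "open \<Omega>" "bounded \<Omega>" and uv: "H1 \<Omega> u" "H1 \<Omega> v"
  shows "H1 \<Omega> (\<lambda>x. s * u x + t * v x)"
    and "AE x in lebesgue. x \<in> \<Omega> \<longrightarrow>
      grad \<Omega> (\<lambda>x. s * u x + t * v x) x = s *\<^sub>R grad \<Omega> u x + t *\<^sub>R grad \<Omega> v x"
proof -
  have L: "L2 lebesgue \<Omega> u" "L2 lebesgue \<Omega> v" using uv by (simp_all add: H1_def)
  have w: "weak_grad \<Omega> (\<lambda>x. s * u x + t * v x) (\<lambda>x. s *\<^sub>R grad \<Omega> u x + t *\<^sub>R grad \<Omega> v x)"
    by (intro weak_grad_lincomb O L H1_grad uv)
  have LG: "L2 lebesgue \<Omega> (\<lambda>x. (s *\<^sub>R grad \<Omega> u x + t *\<^sub>R grad \<Omega> v x) $ i)" for i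
    using L2_lincomb[OF H1_grad(1)[OF uv(1), of i] H1_grad(1)[OF uv(2), of i], of s t] by simp
  show *: "H1 \<Omega> (\<lambda>x. s * u x + t * v x)"
    unfolding H1_def by (intro conjI exI[of _ "\<lambda>x. s *\<^sub>R grad \<Omega> u x + t *\<^sub>R grad \<Omega> v x"] allI
        L2_lincomb[OF L] w LG)
  show "AE x in lebesgue. x \<in> \<Omega> \<longrightarrow>
      grad \<Omega> (\<lambda>x. s * u x + t * v x) x = s *\<^sub>R grad \<Omega> u x + t *\<^sub>R grad \<Omega> v x"
    by (rule weak_grad_unique[OF O H1_grad[OF *] LG w])
qed

section \<open>Existence of traces\<close>

definition has_trace :: "(real^'n::finite) set \<Rightarrow> (real^'n \<Rightarrow> real) \<Rightarrow> bool" where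
  "has_trace \<Omega> v \<longleftrightarrow> (\<exists>g. trace_rel \<Omega> v g)"

text \<open>This is the part of \<open>trace_rel\<close> that does not see the boundary: convergence
  of smooth functions in the H^1 norm.\<close>

definition H1_approx :: "(real^'n::finite) set \<Rightarrow> (real^'n \<Rightarrow> real) \<Rightarrow> (nat \<Rightarrow> real^'n \<Rightarrow> real) \<Rightarrow> bool" where
  "H1_approx \<Omega> v \<phi> \<longleftrightarrow> (\<forall>k. smooth (\<phi> k)) \<and>
     (\<lambda>k. L2_norm lebesgue \<Omega> (\<lambda>x. \<phi> k x - v x)) \<longlonglongrightarrow> 0 \<and>
     (\<forall>i. (\<lambda>k. L2_norm lebesgue \<Omega> (\<lambda>x. cgrad (\<phi> k) x $ i - grad \<Omega> v x $ i)) \<longlonglongrightarrow> 0)"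

lemma trace_rel_iff:
  "trace_rel \<Omega> v g \<longleftrightarrow> L2 surf (frontier \<Omega>) g \<and>
     (\<exists>\<phi>. H1_approx \<Omega> v \<phi> \<and> (\<lambda>k. L2_norm surf (frontier \<Omega>) (\<lambda>x. \<phi> k x - g x)) \<longlonglongrightarrow> 0)"
  unfolding trace_rel_def H1_approx_def by (simp only: conj_assoc)

lemma H1_approx_lincomb:
  assumes O: "open \<Omega>" "bounded \<Omega>" and uv: "H1 \<Omega> u" "H1 \<Omega> v"
    and a: "H1_approx \<Omega> u \<phi>" "H1_approx \<Omega> v \<psi>"
  shows "H1_approx \<Omega> (\<lambda>x. s * u x + t * v x) (\<lambda>k x. s * \<phi> k x + t * \<psi> k x)"
  unfolding H1_approx_def
proof (intro conjI allI)
  have sm: "smooth (\<phi> k)" "smooth (\<psi> k)" for k using a by (simp_all add: H1_approx_def)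
  show "smooth (\<lambda>x. s * \<phi> k x + t * \<psi> k x)" for k by (intro smooth_lincomb sm)
  have L: "L2 lebesgue \<Omega> u" "L2 lebesgue \<Omega> v" using uv by (simp_all add: H1_def)
  have "(\<lambda>k. L2_norm lebesgue \<Omega> (\<lambda>x. s * (\<phi> k x - u x) + t * (\<psi> k x - v x))) \<longlonglongrightarrow> 0"
    using a unfolding H1_approx_def
    by (intro L2_norm_lincomb_tendsto_0 L2_diff smooth_L2 O sm L) blast+
  moreover have "(\<lambda>x. s * (\<phi> k x - u x) + t * (\<psi> k x - v x)) =
      (\<lambda>x. (s * \<phi> k x + t * \<psi> k x) - (s * u x + t * v x))" for k
    by (rule ext) (simp add: algebra_simps)
  ultimately show "(\<lambda>k. L2_norm lebesgue \<Omega> (\<lambda>x. (s * \<phi> k x + t * \<psi> k x) - (s * u x + t * v x))) \<longlonglongrightarrow> 0"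
    by (simp only:)
  show "(\<lambda>k. L2_norm lebesgue \<Omega> (\<lambda>x. cgrad (\<lambda>x. s * \<phi> k x + t * \<psi> k x) x $ i -
      grad \<Omega> (\<lambda>x. s * u x + t * v x) x $ i)) \<longlonglongrightarrow> 0" for i
  proof -
    have "(\<lambda>k. L2_norm lebesgue \<Omega> (\<lambda>x. s * (cgrad (\<phi> k) x $ i - grad \<Omega> u x $ i)
         + t * (cgrad (\<psi> k) x $ i - grad \<Omega> v x $ i))) \<longlonglongrightarrow> 0"
      using a unfolding H1_approx_def
      by (intro L2_norm_lincomb_tendsto_0 L2_diff smooth_L2_cgrad O sm H1_grad(1) uv) blast+
    moreover have "L2_norm lebesgue \<Omega> (\<lambda>x. s * (cgrad (\<phi> k) x $ i - grad \<Omega> u x $ i)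
         + t * (cgrad (\<psi> k) x $ i - grad \<Omega> v x $ i)) =
      L2_norm lebesgue \<Omega> (\<lambda>x. cgrad (\<lambda>x. s * \<phi> k x + t * \<psi> k x) x $ i -
      grad \<Omega> (\<lambda>x. s * u x + t * v x) x $ i)" for k
    proof (rule L2_norm_lebesgue_cong_AE)
      show "AE x in lebesgue. x \<in> \<Omega> \<longrightarrow> s * (cgrad (\<phi> k) x $ i - grad \<Omega> u x $ i)
         + t * (cgrad (\<psi> k) x $ i - grad \<Omega> v x $ i) = cgrad (\<lambda>x. s * \<phi> k x + t * \<psi> k x) x $ i -
      grad \<Omega> (\<lambda>x. s * u x + t * v x) x $ i"
        using H1_lincomb(2)[OF O uv, of s t]
        by eventually_elim (auto simp: cgrad_lincomb[OF sm] algebra_simps)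
    qed
    ultimately show ?thesis by (simp only:)
  qed
qed

text \<open>A multiple of a fixed smooth function with coefficients tending to 0 is negligible in
  the H^1 norm. This leaves freedom to change the behaviour of the approximants on the
  boundary.\<close>

lemma H1_approx_perturb:
  assumes O: "open \<Omega>" "bounded \<Omega>" and u: "H1 \<Omega> u"
    and a: "H1_approx \<Omega> u \<phi>" and th: "smooth \<theta>" and e: "e \<longlonglongrightarrow> 0"
  shows "H1_approx \<Omega> u (\<lambda>k x. \<phi> k x + e k * \<theta> x)"
  unfolding H1_approx_def
proof (intro conjI allI)
  have sm: "smooth (\<phi> k)" for k using a by (simp add: H1_approx_def)
  have p: "(\<lambda>x. \<phi> k x + e k * \<theta> x) = (\<lambda>x. 1 * \<phi> k x + e k * \<theta> x)" for k by simp
  show "smooth (\<lambda>x. \<phi> k x + e k * \<theta> x)" for k unfolding p by (intro smooth_lincomb sm th)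
  have small: "(\<lambda>k. L2_norm lebesgue \<Omega> (\<lambda>x. 1 * f k x + e k * g x)) \<longlonglongrightarrow> 0"
    if "\<And>k. L2 lebesgue \<Omega> (f k)" "L2 lebesgue \<Omega> g" "(\<lambda>k. L2_norm lebesgue \<Omega> (f k)) \<longlonglongrightarrow> 0" for f g
  proof (rule tendsto_sandwich[of "\<lambda>_. 0"])
    show "\<forall>\<^sub>F k in sequentially. 0 \<le> L2_norm lebesgue \<Omega> (\<lambda>x. 1 * f k x + e k * g x)"
      by (intro always_eventually allI L2_norm_nonneg)
    show "\<forall>\<^sub>F k in sequentially. L2_norm lebesgue \<Omega> (\<lambda>x. 1 * f k x + e k * g x)
        \<le> \<bar>1\<bar> * L2_norm lebesgue \<Omega> (f k) + \<bar>e k\<bar> * L2_norm lebesgue \<Omega> g"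
      by (intro always_eventually allI L2_norm_lincomb_le that(1,2))
    have "(\<lambda>k. \<bar>1\<bar> * L2_norm lebesgue \<Omega> (f k) + \<bar>e k\<bar> * L2_norm lebesgue \<Omega> g)
       \<longlonglongrightarrow> \<bar>1\<bar> * 0 + \<bar>0\<bar> * L2_norm lebesgue \<Omega> g"
      by (intro tendsto_intros that(3) e)
    then show "(\<lambda>k. \<bar>1\<bar> * L2_norm lebesgue \<Omega> (f k) + \<bar>e k\<bar> * L2_norm lebesgue \<Omega> g) \<longlonglongrightarrow> 0"
      by simp
  qed simp
  have L: "L2 lebesgue \<Omega> u" using u by (simp add: H1_def)
  have "(\<lambda>k. L2_norm lebesgue \<Omega> (\<lambda>x. 1 * (\<phi> k x - u x) + e k * \<theta> x)) \<longlonglongrightarrow> 0"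
    using a unfolding H1_approx_def by (intro small L2_diff smooth_L2 O sm th L) blast+
  moreover have "(\<lambda>x. 1 * (\<phi> k x - u x) + e k * \<theta> x) = (\<lambda>x. \<phi> k x + e k * \<theta> x - u x)" for k
    by (rule ext) simp
  ultimately show "(\<lambda>k. L2_norm lebesgue \<Omega> (\<lambda>x. \<phi> k x + e k * \<theta> x - u x)) \<longlonglongrightarrow> 0"
    by (simp only:)
  show "(\<lambda>k. L2_norm lebesgue \<Omega> (\<lambda>x. cgrad (\<lambda>x. \<phi> k x + e k * \<theta> x) x $ i - grad \<Omega> u x $ i)) \<longlonglongrightarrow> 0" for i
  proof -
    have "(\<lambda>k. L2_norm lebesgue \<Omega> (\<lambda>x. 1 * (cgrad (\<phi> k) x $ i - grad \<Omega> u x $ i) + e k * cgrad \<theta> x $ i)) \<longlonglongrightarrow> 0"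
      using a unfolding H1_approx_def
      by (intro small L2_diff smooth_L2_cgrad O sm th H1_grad(1) u) blast+
    moreover have "(\<lambda>x. 1 * (cgrad (\<phi> k) x $ i - grad \<Omega> u x $ i) + e k * cgrad \<theta> x $ i)
        = (\<lambda>x. cgrad (\<lambda>x. \<phi> k x + e k * \<theta> x) x $ i - grad \<Omega> u x $ i)" for k
      unfolding p cgrad_lincomb[OF sm th] by (rule ext) simp
    ultimately show ?thesis by (simp only:)
  qed
qed

lemma smooth_const: "smooth (\<lambda>x. r)"
  by (rule bump_alg_smooth) (rule bump_alg.const)

text \<open>The constant \<^const>\<open>L2_norm\<close> is 0 on functions that are not square integrable. If every smooth
  function is square integrable over the boundary, the norms in \<^const>\<open>trace_rel\<close> are genuine and
  traces add up. Otherwise an arbitrarily small multiple of an offending smooth function can be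
  added to the approximants to make the boundary norms vanish, so every limit of smooth functions
  has the trace 0.\<close>

lemma has_trace_lincomb:
  fixes \<Omega> :: "(real^'n::finite) set"
  assumes O: "open \<Omega>" "bounded \<Omega>" and uv: "H1 \<Omega> u" "H1 \<Omega> v"
    and tr: "has_trace \<Omega> u" "has_trace \<Omega> v"
  shows "has_trace \<Omega> (\<lambda>x. s * u x + t * v x)"
proof -
  let ?F = "frontier \<Omega>"
  let ?Q = "\<lambda>f. set_integrable surf ?F (\<lambda>x. (f x)\<^sup>2)"
  obtain g \<phi> where g: "L2 surf ?F g" "H1_approx \<Omega> u \<phi>"
      "(\<lambda>k. L2_norm surf ?F (\<lambda>x. \<phi> k x - g x)) \<longlonglongrightarrow> 0"
    using tr(1) unfolding has_trace_def trace_rel_iff by blast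
  obtain h \<psi> where h: "L2 surf ?F h" "H1_approx \<Omega> v \<psi>"
      "(\<lambda>k. L2_norm surf ?F (\<lambda>x. \<psi> k x - h x)) \<longlonglongrightarrow> 0"
    using tr(2) unfolding has_trace_def trace_rel_iff by blast
  have ap: "H1_approx \<Omega> (\<lambda>x. s * u x + t * v x) (\<lambda>k x. s * \<phi> k x + t * \<psi> k x)"
    by (rule H1_approx_lincomb[OF O uv g(2) h(2)])
  show ?thesis
  proof (cases "\<forall>\<theta>. smooth \<theta> \<longrightarrow> ?Q \<theta>")
    case True
    have L2s: "L2 surf ?F \<theta>" if "smooth \<theta>" for \<theta>
    proof -
      \<comment> \<open>The identity ((\<theta> + 1)^2 - (\<theta> - 1)^2) / 4 = \<theta> extracts
        integrability of \<theta>, and with it measurability, from the integrability of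
        squares.\<close>
      have Q: "?Q (\<lambda>x. 1 * \<theta> x + 1 * 1)" "?Q (\<lambda>x. 1 * \<theta> x + (-1) * 1)"
        using True smooth_lincomb[OF that smooth_const] by blast+
      have "set_integrable surf ?F (\<lambda>x. (1 / 4) * ((1 * \<theta> x + 1 * 1)\<^sup>2 - (1 * \<theta> x + (-1) * 1)\<^sup>2))"
        by (intro set_integrable_mult_right set_integral_diff Q)
      moreover have "(\<lambda>x. (1 / 4) * ((1 * \<theta> x + 1 * 1)\<^sup>2 - (1 * \<theta> x + (-1) * 1)\<^sup>2)) = \<theta>"
        by (rule ext) (simp add: power2_eq_square algebra_simps)
      ultimately have "set_integrable surf ?F \<theta>" by (simp only:)
      then have "set_borel_measurable surf ?F \<theta>"
        unfolding set_integrable_def set_borel_measurable_def by (rule borel_measurable_integrable)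
      then show ?thesis using True that by (simp add: L2_def)
    qed
    have sm: "smooth (\<phi> k)" "smooth (\<psi> k)" for k using g(2) h(2) by (simp_all add: H1_approx_def)
    have "(\<lambda>k. L2_norm surf ?F (\<lambda>x. s * (\<phi> k x - g x) + t * (\<psi> k x - h x))) \<longlonglongrightarrow> 0"
      by (intro L2_norm_lincomb_tendsto_0 L2_diff L2s sm g h)
    moreover have "(\<lambda>x. s * (\<phi> k x - g x) + t * (\<psi> k x - h x)) =
        (\<lambda>x. (s * \<phi> k x + t * \<psi> k x) - (s * g x + t * h x))" for k
      by (rule ext) (simp add: algebra_simps)
    ultimately have "(\<lambda>k. L2_norm surf ?F (\<lambda>x. (s * \<phi> k x + t * \<psi> k x) - (s * g x + t * h x))) \<longlonglongrightarrow> 0"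
      by (simp only:)
    then show ?thesis unfolding has_trace_def trace_rel_iff
      using ap L2_lincomb[OF g(1) h(1), of s t] by blast
  next
    case False
    then obtain \<theta> where th: "smooth \<theta>" "\<not> ?Q \<theta>" by blast
    define f where "f = (\<lambda>k x. s * \<phi> k x + t * \<psi> k x)"
    have ex: "\<exists>e. \<bar>e\<bar> \<le> inverse (real (Suc k)) \<and> \<not> ?Q (\<lambda>x. f k x + e * \<theta> x)" for k
    proof (rule ccontr)
      let ?e = "inverse (real (Suc k))"
      assume "\<not> ?thesis"
      then have Q: "\<bar>e\<bar> \<le> ?e \<Longrightarrow> ?Q (\<lambda>x. f k x + e * \<theta> x)" for e by blast
      \<comment> \<open>By the parallelogram law (f + e \<theta>)^2 + (f - e \<theta>)^2 - 2 f^2 = 2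
        e^2 \<theta>^2, the squares for the three coefficients e, -e and 0 cannot all be
        integrable.\<close>
      have "set_integrable surf ?F (\<lambda>x. (1 / (2 * ?e\<^sup>2)) * (((f k x + ?e * \<theta> x)\<^sup>2 + (f k x + (- ?e) * \<theta> x)\<^sup>2)
          - 2 * (f k x + 0 * \<theta> x)\<^sup>2))"
        by (intro set_integrable_mult_right set_integral_diff set_integral_add Q) auto
      moreover have "?e \<noteq> 0" by simp
      then have "(1 / (2 * ?e\<^sup>2)) * (((f k x + ?e * \<theta> x)\<^sup>2 + (f k x + (- ?e) * \<theta> x)\<^sup>2)
          - 2 * (f k x + 0 * \<theta> x)\<^sup>2) = (\<theta> x)\<^sup>2" for x
        by (simp add: power2_eq_square algebra_simps del: of_nat_Suc)
      ultimately show False using th(2) by (simp only:)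
    qed
    then obtain e where e: "\<And>k. \<bar>e k\<bar> \<le> inverse (real (Suc k))" "\<And>k. \<not> ?Q (\<lambda>x. f k x + e k * \<theta> x)"
      by metis
    have "e \<longlonglongrightarrow> 0"
      by (rule Lim_null_comparison[OF _ LIMSEQ_inverse_real_of_nat])
         (intro always_eventually allI, simp only: real_norm_def e)
    then have 1: "H1_approx \<Omega> (\<lambda>x. s * u x + t * v x) (\<lambda>k x. f k x + e k * \<theta> x)"
      using H1_approx_perturb[OF O H1_lincomb(1)[OF O uv] ap th(1)] unfolding f_def by blast
    have "L2_norm surf ?F (\<lambda>x. (f k x + e k * \<theta> x) - 0) = 0" for k
      using e(2)[of k] unfolding L2_norm_def set_lebesgue_integral_def set_integrable_def
      by (simp add: not_integrable_integral_eq)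
    then have "(\<lambda>k. L2_norm surf ?F (\<lambda>x. (f k x + e k * \<theta> x) - 0)) \<longlonglongrightarrow> 0" by simp
    then show ?thesis unfolding has_trace_def trace_rel_iff
      using 1 L2_zero[of surf ?F] by blast
  qed
qed

section \<open>Quadratic forms of matrix fields\<close>

lemma L2_subset:
  assumes "L2 M S f" "T \<subseteq> S" "T \<in> sets M"
  shows "L2 M T f"
proof -
  let ?F = "\<lambda>x. indicator S x * f x"
  have m[measurable]: "?F \<in> borel_measurable M" and i: "integrable M (\<lambda>x. (?F x)\<^sup>2)"
    using assms by (auto simp: L2_iff)
  have T[measurable]: "T \<in> sets M" by fact
  have e: "(\<lambda>x. indicator T x * ?F x) = (\<lambda>x. indicator T x * f x)"
    using assms(2) by (auto simp: fun_eq_iff split: split_indicator)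
  have e2: "(\<lambda>x. indicator T x *\<^sub>R (?F x)\<^sup>2) = (\<lambda>x. (indicator T x * f x)\<^sup>2)"
    using assms(2) by (auto simp: fun_eq_iff split: split_indicator)
  have "(\<lambda>x. indicator T x * ?F x) \<in> borel_measurable M" by measurable
  moreover have "integrable M (\<lambda>x. indicator T x *\<^sub>R (?F x)\<^sup>2)"
    using T i by (rule integrable_mult_indicator)
  ultimately show ?thesis unfolding L2_iff e e2 by (rule conjI)
qed

lemma L2_inner_integrable:
  fixes f g :: "'a \<Rightarrow> real^'n::finite"
  assumes "\<And>i. L2 M S (\<lambda>x. f x $ i)" "\<And>i. L2 M S (\<lambda>x. g x $ i)"
  shows "set_integrable M S (\<lambda>x. f x \<bullet> g x)"
  unfolding inner_vec_def inner_real_def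
  by (intro set_integrable_sumI L2_mult_integrable assms)

lemma L2_matrix_vector_mult:
  fixes A :: "'a \<Rightarrow> real^'n::finite^'n"
  assumes "\<forall>i j. Linf M S (\<lambda>x. A x $ i $ j)" "\<And>i. L2 M S (\<lambda>x. y x $ i)"
  shows "L2 M S (\<lambda>x. (A x *v y x) $ i)"
  unfolding matrix_vector_mult_def vec_lambda_beta
  by (intro L2_sum L2_Linf_mult assms(1)[rule_format] assms(2))

text \<open>Coercivity makes the kernel trivial, hence the matrix invertible. With y the solution of
  A y = b, the estimate a0 |y|^2 \<le> y \<bullet> b \<le> |y| |b| bounds the inverse.\<close>

lemma positive_definite_matrix_inv:
  fixes A :: "real^'n::finite^'n"
  assumes a0: "a0 > 0" and pd: "\<And>\<xi>. \<xi> \<bullet> (A *v \<xi>) \<ge> a0 * (norm \<xi>)\<^sup>2"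
  shows "det A \<noteq> 0" "A *v (matrix_inv A *v b) = b" "norm (matrix_inv A *v b) \<le> norm b / a0"
proof -
  have "\<xi> = 0" if "A *v \<xi> = 0" for \<xi>
  proof -
    have "a0 * (norm \<xi>)\<^sup>2 \<le> 0" using pd[of \<xi>] that by simp
    then show ?thesis using a0 by (simp add: mult_le_0_iff)
  qed
  then have inv: "invertible A"
    using matrix_left_invertible_ker[of A] invertible_left_inverse[of A] by blast
  then show "det A \<noteq> 0" by (simp add: invertible_det_nz)
  have "A ** matrix_inv A = mat 1" using someI_ex[OF inv[unfolded invertible_def]] by (simp add: matrix_inv_def)
  then show Ay: "A *v (matrix_inv A *v b) = b"
    by (simp add: matrix_vector_mul_assoc)
  define y where "y = matrix_inv A *v b"
  have "a0 * (norm y)\<^sup>2 \<le> norm y * norm b"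
    using pd[of y] Ay norm_cauchy_schwarz[of y b] unfolding y_def by simp
  then have "norm y * (a0 * norm y) \<le> norm y * norm b"
    by (simp add: power2_eq_square mult.left_commute)
  then have "a0 * norm y \<le> norm b"
    by (cases "norm y = 0") (auto simp: mult_le_cancel_left)
  then show "norm (matrix_inv A *v b) \<le> norm b / a0"
    using a0 by (simp add: y_def field_simps)
qed

text \<open>Cramer's rule expresses the component as a quotient of determinants of measurable
  functions, which gives measurability; the bound |q| / a0 then gives square integrability.\<close>

lemma L2_matrix_inv_mult:
  fixes A :: "'a::euclidean_space \<Rightarrow> real^'n::finite^'n"
  assumes A: "\<forall>i j. Linf lebesgue S (\<lambda>x. A x $ i $ j)"
    and pd: "a0 > 0" "AE x in lebesgue. x \<in> S \<longrightarrow> (\<forall>\<xi>. \<xi> \<bullet> (A x *v \<xi>) \<ge> a0 * (norm \<xi>)\<^sup>2)"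
    and q: "\<And>i. L2 lebesgue S (\<lambda>x. q x $ i)" and S: "S \<in> sets lebesgue"
  shows "L2 lebesgue S (\<lambda>x. (matrix_inv (A x) *v q x) $ k)"
proof -
  \<comment> \<open>Entries are cut off by the indicator of \<open>S\<close>, since only these
    extensions by 0 are known to be measurable on the whole space.\<close>
  define K where "K i j x = indicator S x * A x $ i $ j" for i j x
  define Q where "Q i x = indicator S x * q x $ i" for i x
  let ?Y = "\<lambda>x. indicator S x * (matrix_inv (A x) *v q x) $ k"
  have K[measurable]: "K i j \<in> borel_measurable lebesgue" for i j
    using A unfolding K_def Linf_def set_borel_measurable_def by simp
  have Q[measurable]: "Q i \<in> borel_measurable lebesgue" and Qi: "integrable lebesgue (\<lambda>x. (Q i x)\<^sup>2)" for i
    using q[of i] unfolding Q_def L2_iff by simp_all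
  have dm: "(\<lambda>x. det (\<chi> i j. F i j x) :: real) \<in> borel_measurable lebesgue"
    if "\<And>i j. F i j \<in> borel_measurable lebesgue" for F :: "'n \<Rightarrow> 'n \<Rightarrow> 'a \<Rightarrow> real"
    unfolding det_def vec_lambda_beta
    by (intro borel_measurable_sum borel_measurable_times borel_measurable_prod borel_measurable_const that)
  \<comment> \<open>Cramer's quotient, with column \<open>k\<close> of the matrix replaced by the
    right-hand side.\<close>
  define P where "P x = indicator S x * (det (\<chi> i j. (if j = k then Q i else K i j) x) / det (\<chi> i j. K i j x))" for x
  have "P \<in> borel_measurable lebesgue"
    unfolding P_def
    by (intro borel_measurable_times borel_measurable_divide dm borel_measurable_indicator S) (auto intro: K Q)
  moreover have "AE x in lebesgue. P x = ?Y x"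
    using pd(2)
  proof eventually_elim
    case (elim x)
    show ?case
    proof (cases "x \<in> S")
      case True
      then have KQ: "K i j x = A x $ i $ j" "Q i x = q x $ i" for i j by (simp_all add: K_def Q_def)
      note pi = positive_definite_matrix_inv(1,2)[OF pd(1) elim[rule_format, OF True]]
      have "matrix_inv (A x) *v q x = (\<chi> k. det (\<chi> i j. if j = k then q x $ i else A x $ i $ j) / det (A x))"
        using pi(2) by (simp only: cramer[OF pi(1)])
      then have "(matrix_inv (A x) *v q x) $ k = det (\<chi> i j. if j = k then q x $ i else A x $ i $ j) / det (A x)"
        by (simp only: vec_lambda_beta)
      moreover have "(\<chi> i j. (if j = k then Q i else K i j) x) = (\<chi> i j. if j = k then q x $ i else A x $ i $ j)"
        by (simp add: vec_eq_iff KQ)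
      moreover have "(\<chi> i j. K i j x) = A x" by (simp add: vec_eq_iff KQ)
      ultimately show ?thesis by (simp only: P_def)
    qed (simp add: P_def)
  qed
  ultimately have Ym: "?Y \<in> borel_measurable lebesgue" by (rule borel_measurable_AE)
  have "integrable lebesgue (\<lambda>x. (?Y x)\<^sup>2)"
  proof (rule Bochner_Integration.integrable_bound)
    show "integrable lebesgue (\<lambda>x. (\<Sum>i\<in>UNIV. (Q i x)\<^sup>2) / a0\<^sup>2)"
      by (intro integrable_divide_zero Bochner_Integration.integrable_sum Qi)
    show "(\<lambda>x. (?Y x)\<^sup>2) \<in> borel_measurable lebesgue" using Ym by (rule borel_measurable_power)
    show "AE x in lebesgue. norm ((?Y x)\<^sup>2) \<le> norm ((\<Sum>i\<in>UNIV. (Q i x)\<^sup>2) / a0\<^sup>2)"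
      using pd(2)
    proof eventually_elim
      case (elim x)
      have nn: "0 \<le> (\<Sum>i\<in>UNIV. (Q i x)\<^sup>2) / a0\<^sup>2" by (intro divide_nonneg_nonneg sum_nonneg) auto
      show ?case
      proof (cases "x \<in> S")
        case True
        note pi = positive_definite_matrix_inv(3)[where b = "q x", OF pd(1) elim[rule_format, OF True]]
        have "\<bar>(matrix_inv (A x) *v q x) $ k\<bar> \<le> norm (q x) / a0"
          using component_le_norm_cart[of "matrix_inv (A x) *v q x" k] pi by linarith
        then have "((matrix_inv (A x) *v q x) $ k)\<^sup>2 \<le> (norm (q x) / a0)\<^sup>2"
          using power_mono[of "\<bar>(matrix_inv (A x) *v q x) $ k\<bar>" "norm (q x) / a0" 2] by simp
        also have "\<dots> = (\<Sum>i\<in>UNIV. (Q i x)\<^sup>2) / a0\<^sup>2"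
          using True by (simp add: power_divide Q_def norm_vec_def L2_set_def sum_nonneg)
        finally show ?thesis using True nn by (simp only: real_norm_def abs_of_nonneg indicator_simps mult_1_left zero_le_power2)
      qed (use nn in simp)
    qed
  qed
  then show ?thesis unfolding L2_iff using Ym by blast
qed

text \<open>The form of A(x) at y + t z is a nonnegative quadratic in t; symmetry of A(x) merges its
  two mixed terms.\<close>

lemma quadratic_form_Cauchy_Schwarz:
  fixes A :: "'a \<Rightarrow> real^'n::finite^'n"
  assumes A: "\<forall>i j. Linf M S (\<lambda>x. A x $ i $ j)"
    and sym: "AE x in M. x \<in> S \<longrightarrow> transpose (A x) = A x"
    and psd: "AE x in M. x \<in> S \<longrightarrow> (\<forall>\<xi>. \<xi> \<bullet> (A x *v \<xi>) \<ge> 0)"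
    and y: "\<And>i. L2 M S (\<lambda>x. y x $ i)" and z: "\<And>i. L2 M S (\<lambda>x. z x $ i)"
  shows "\<bar>LINT x:S|M. (A x *v y x) \<bullet> z x\<bar>
     \<le> sqrt (LINT x:S|M. (A x *v y x) \<bullet> y x) * sqrt (LINT x:S|M. (A x *v z x) \<bullet> z x)"
proof (rule set_integral_quadratic_Cauchy_Schwarz)
  show "AE x in M. x \<in> S \<longrightarrow> (\<forall>t. 0 \<le> (A x *v y x) \<bullet> y x + 2 * t * ((A x *v y x) \<bullet> z x)
      + t\<^sup>2 * ((A x *v z x) \<bullet> z x))"
    using sym psd
  proof (eventually_elim, intro impI allI)
    fix x t assume h: "x \<in> S \<longrightarrow> transpose (A x) = A x" "x \<in> S \<longrightarrow> (\<forall>\<xi>. \<xi> \<bullet> (A x *v \<xi>) \<ge> 0)" "x \<in> S"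
    have "(A x *v z x) \<bullet> y x = z x \<bullet> (A x *v y x)"
      using h by (metis dot_lmul_matrix transpose_matrix_vector)
    then have s: "y x \<bullet> (A x *v z x) = z x \<bullet> (A x *v y x)" by (simp add: inner_commute)
    have "0 \<le> (y x + t *\<^sub>R z x) \<bullet> (A x *v (y x + t *\<^sub>R z x))" using h by blast
    also have "\<dots> = (A x *v y x) \<bullet> y x + 2 * t * ((A x *v y x) \<bullet> z x) + t\<^sup>2 * ((A x *v z x) \<bullet> z x)"
      by (simp add: matrix_vector_right_distrib matrix_vector_mult_scaleR inner_add_left inner_add_right s
          inner_commute[of "A x *v y x"] inner_commute[of "A x *v z x"] power2_eq_square algebra_simps)
    finally show "0 \<le> (A x *v y x) \<bullet> y x + 2 * t * ((A x *v y x) \<bullet> z x) + t\<^sup>2 * ((A x *v z x) \<bullet> z x)" .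
  qed
qed (intro L2_inner_integrable L2_matrix_vector_mult A y z)+

section \<open>Functions with and without a trace\<close>

lemma tr_L2:
  assumes "has_trace \<Omega> v"
  shows "L2 surf (frontier \<Omega>) (tr \<Omega> v)"
  using someI_ex[OF assms[unfolded has_trace_def]] unfolding tr_def trace_rel_def by blast

text \<open>Both sides are the junk value \<open>SOME g. False\<close>.\<close>

lemma tr_eq_if_no_trace:
  assumes "\<not> has_trace \<Omega> u" "\<not> has_trace \<Omega> v"
  shows "tr \<Omega> u = tr \<Omega> v"
proof -
  have "trace_rel \<Omega> u = trace_rel \<Omega> v" using assms by (auto simp: has_trace_def fun_eq_iff)
  then show ?thesis by (simp only: tr_def)
qed

text \<open>The boundary condition inspects only \<open>tr\<close>, whose value all functions
  without a trace share, so it passes from \<open>u\<close> to \<open>v\<close>.\<close>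

lemma H1_0_no_trace:
  assumes "u \<in> H1_0 \<Omega> \<Gamma>" "\<not> has_trace \<Omega> u" "H1 \<Omega> v" "\<not> has_trace \<Omega> v"
  shows "v \<in> H1_0 \<Omega> \<Gamma>"
  using assms tr_eq_if_no_trace[of \<Omega> u v] by (simp add: H1_0_def)

text \<open>The two functions have the same weak gradients, so the choice operator picks the same
  \<open>grad\<close> for both, and the volume norms ignore null sets.\<close>

lemma has_trace_cong_AE:
  assumes "AE x in lebesgue. x \<in> \<Omega> \<longrightarrow> u x = v x"
  shows "has_trace \<Omega> u \<longleftrightarrow> has_trace \<Omega> v"
proof -
  have "weak_grad \<Omega> u G = weak_grad \<Omega> v G" for G
  proof -
    have "(LINT x:\<Omega>|lebesgue. u x * f x) = (LINT x:\<Omega>|lebesgue. v x * f x)" for f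
      by (rule set_integral_lebesgue_cong_AE) (use assms in eventually_elim, simp)
    then show ?thesis by (simp only: weak_grad_def)
  qed
  then have "grad \<Omega> u = grad \<Omega> v" by (simp only: grad_def)
  moreover have "L2_norm lebesgue \<Omega> (\<lambda>x. f x - u x) = L2_norm lebesgue \<Omega> (\<lambda>x. f x - v x)" for f
    by (rule L2_norm_lebesgue_cong_AE) (use assms in eventually_elim, simp)
  ultimately show ?thesis by (simp only: has_trace_def trace_rel_def)
qed

text \<open>A trace of 2 v would give one of v, which is half of it.\<close>

lemma no_trace_double:
  assumes O: "open \<Omega>" "bounded \<Omega>" and v: "H1 \<Omega> v" "\<not> has_trace \<Omega> v"
  shows "H1 \<Omega> (\<lambda>x. 2 * v x)" "\<not> has_trace \<Omega> (\<lambda>x. 2 * v x)"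
proof -
  show H: "H1 \<Omega> (\<lambda>x. 2 * v x)" using H1_lincomb(1)[OF O v(1) v(1), of 2 0] by simp
  show "\<not> has_trace \<Omega> (\<lambda>x. 2 * v x)"
    using has_trace_lincomb[OF O H H, of "1/2" 0] v(2) by auto
qed

section \<open>The guaranteed bound\<close>

theorem theorem6p2:
  fixes \<Omega> \<Gamma>D \<Gamma>N :: "(real^'n::finite) set"
    and A :: "real^'n \<Rightarrow> real^'n^'n"
    and c \<alpha> :: "real^'n \<Rightarrow> real"
    and CF CT :: real
    and u w :: "real^'n \<Rightarrow> real"
    and lam :: real
    and q :: "real^'n \<Rightarrow> real^'n"
    and qn :: "real^'n \<Rightarrow> real"
  assumes dom: "lipschitz_domain \<Omega>"
    and GD_open: "openin (top_of_set (frontier \<Omega>)) \<Gamma>D"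
    and GN_open: "openin (top_of_set (frontier \<Omega>)) \<Gamma>N"
    and G_disj: "\<Gamma>D \<inter> \<Gamma>N = {}"
    and G_cover: "frontier \<Omega> = closure \<Gamma>D \<union> closure \<Gamma>N"
    and GN_meas: "emeasure surf \<Gamma>N > 0"
    and A_Linf: "\<forall>i j. Linf lebesgue \<Omega> (\<lambda>x. A x $ i $ j)"
    and A_sym: "AE x in lebesgue. x \<in> \<Omega> \<longrightarrow> transpose (A x) = A x"
    and A_pd: "\<exists>a0>0. AE x in lebesgue. x \<in> \<Omega> \<longrightarrow>
                 (\<forall>\<xi>. \<xi> \<bullet> (A x *v \<xi>) \<ge> a0 * (norm \<xi>)\<^sup>2)"
    and c_Linf: "Linf lebesgue \<Omega> c"
    and c_nonneg: "AE x in lebesgue. x \<in> \<Omega> \<longrightarrow> c x \<ge> 0"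
    and alpha_Linf: "Linf surf \<Gamma>N \<alpha>"
    and alpha_nonneg: "AE x in surf. x \<in> \<Gamma>N \<longrightarrow> \<alpha> x \<ge> 0"
    and a_sp: "scalar_product_on (H1_0 \<Omega> \<Gamma>D) (aform \<Omega> \<Gamma>N A c \<alpha>) lebesgue \<Omega>"
    and CF_def: "least_real {C. C \<ge> 0 \<and> (\<forall>v \<in> H1_0 \<Omega> \<Gamma>D.
                   L2_norm lebesgue \<Omega> v \<le> C * sqrt (aform \<Omega> \<Gamma>N A c \<alpha> v v))} CF"
    and CT_def: "least_real {C. C \<ge> 0 \<and> (\<forall>v \<in> H1_0 \<Omega> \<Gamma>D.
                   L2_norm surf \<Gamma>N (tr \<Omega> v) \<le> C * sqrt (aform \<Omega> \<Gamma>N A c \<alpha> v v))} CT"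
    and u_V: "u \<in> H1_0 \<Omega> \<Gamma>D"
    and w_V: "w \<in> H1_0 \<Omega> \<Gamma>D"
    and w_eq: "\<forall>v \<in> H1_0 \<Omega> \<Gamma>D. aform \<Omega> \<Gamma>N A c \<alpha> w v =
                 aform \<Omega> \<Gamma>N A c \<alpha> u v - lam * (LINT x:\<Gamma>N|surf. tr \<Omega> u x * tr \<Omega> v x)"
    and q_Hdiv: "Hdiv \<Omega> q"
    and q_normal: "normal_trace_on \<Omega> \<Gamma>D \<Gamma>N q qn"
  shows "sqrt (aform \<Omega> \<Gamma>N A c \<alpha> w w)
         \<le> sqrt (LINT x:\<Omega>|lebesgue.
                   (A x *v (grad \<Omega> u x - matrix_inv (A x) *v q x)) \<bullet> (grad \<Omega> u x - matrix_inv (A x) *v q x))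
           + CF * L2_norm lebesgue \<Omega> (\<lambda>x. c x * u x - divg \<Omega> q x)
           + CT * L2_norm surf \<Gamma>N (\<lambda>x. \<alpha> x * tr \<Omega> u x - lam * tr \<Omega> u x + qn x)"
proof -
  let ?V = "H1_0 \<Omega> \<Gamma>D"
  define a where "a = aform \<Omega> \<Gamma>N A c \<alpha>"
  define y where "y x = grad \<Omega> u x - matrix_inv (A x) *v q x" for x
  define N where "N = sqrt (a w w)"
  define N1 where "N1 = sqrt (LINT x:\<Omega>|lebesgue. (A x *v y x) \<bullet> y x)"
  define N2 where "N2 = L2_norm lebesgue \<Omega> (\<lambda>x. c x * u x - divg \<Omega> q x)"
  define N3 where "N3 = L2_norm surf \<Gamma>N (\<lambda>x. \<alpha> x * tr \<Omega> u x - lam * tr \<Omega> u x + qn x)"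
  have O: "open \<Omega>" "bounded \<Omega>" using dom by (simp_all add: lipschitz_domain_def)
  have OS: "\<Omega> \<in> sets lebesgue" using O(1) by auto
  \<comment> \<open>The measure of a set outside the \<sigma>-algebra is 0 by default, so positive
    measure forces measurability.\<close>
  have GN: "\<Gamma>N \<in> sets surf" using GN_meas by (metis emeasure_notin_sets less_irrefl)
  have GN_sub: "\<Gamma>N \<subseteq> frontier \<Omega>" using GN_open openin_imp_subset by blast
  obtain a0 where a0: "a0 > 0" "AE x in lebesgue. x \<in> \<Omega> \<longrightarrow> (\<forall>\<xi>. \<xi> \<bullet> (A x *v \<xi>) \<ge> a0 * (norm \<xi>)\<^sup>2)"
    using A_pd by blast
  have psd: "AE x in lebesgue. x \<in> \<Omega> \<longrightarrow> (\<forall>\<xi>. \<xi> \<bullet> (A x *v \<xi>) \<ge> 0)"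
    using a0(2)
  proof eventually_elim
    case (elim x)
    have "0 \<le> a0 * (norm \<xi>)\<^sup>2" for \<xi> :: "real^'n" using a0(1) by simp
    then show ?case using elim order_trans by blast
  qed
  have sym: "a v v' = a v' v" if "v \<in> ?V" "v' \<in> ?V" for v v'
    using a_sp that unfolding scalar_product_on_def a_def by blast
  have lin: "a (\<lambda>x. s * v x + t * v' x) z = s * a v z + t * a v' z"
    if "v \<in> ?V" "v' \<in> ?V" "z \<in> ?V" for s t v v' z
    using a_sp that unfolding scalar_product_on_def a_def by blast
  \<comment> \<open>Linearity is given in the first argument; symmetry carries it over to the
    second.\<close>
  have dbl: "a z (\<lambda>x. 2 * v x) = 2 * a z v"
    if "v \<in> ?V" "z \<in> ?V" "(\<lambda>x. 2 * v x) \<in> ?V" for v z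
    using lin[OF that(1,1,2), of 2 0] sym[OF that(2,3)] sym[OF that(2,1)] by simp
  have eq: "a w v = a u v - lam * (LINT x:\<Gamma>N|surf. tr \<Omega> u x * tr \<Omega> v x)" if "v \<in> ?V" for v
    using w_eq that unfolding a_def by blast
  have Hu: "H1 \<Omega> u" and Hw: "H1 \<Omega> w" using u_V w_V by (simp_all add: H1_0_def)
  have Lu: "L2 lebesgue \<Omega> u" and Lw: "L2 lebesgue \<Omega> w" using Hu Hw by (simp_all add: H1_def)
  note Gu = H1_grad(1)[OF Hu] and Gw = H1_grad(1)[OF Hw]
  have Lq: "L2 lebesgue \<Omega> (\<lambda>x. q x $ i)" for i using q_Hdiv by (simp add: Hdiv_def)
  have Ld: "L2 lebesgue \<Omega> (divg \<Omega> q)"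
    using q_Hdiv someI_ex[of "\<lambda>D. L2 lebesgue \<Omega> D \<and> weak_div \<Omega> q D"]
    unfolding divg_def Hdiv_def by blast
  have Ly: "L2 lebesgue \<Omega> (\<lambda>x. y x $ i)" for i
    using L2_diff[OF Gu L2_matrix_inv_mult[OF A_Linf a0 Lq OS]] by (simp add: y_def)

  have trace_u: "has_trace \<Omega> u" if tw: "has_trace \<Omega> w"
  proof (rule ccontr)
    assume nu: "\<not> has_trace \<Omega> u"
    define v where "v = (\<lambda>x. 1 * w x + (-1) * u x)"
    have Hv: "H1 \<Omega> v" unfolding v_def by (rule H1_lincomb(1)[OF O Hw Hu])
    have nv: "\<not> has_trace \<Omega> v"
    proof
      assume "has_trace \<Omega> v"
      \<comment> \<open>If w - u had a trace, so would u = w - (w - u).\<close>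
      from has_trace_lincomb[OF O Hw Hv tw this, of 1 "-1"]
      have "has_trace \<Omega> (\<lambda>x. 1 * w x + (-1) * v x)" .
      moreover have "(\<lambda>x. 1 * w x + (-1) * v x) = u" by (rule ext) (simp add: v_def)
      ultimately show False using nu by (simp only:)
    qed
    have vV: "v \<in> ?V" by (rule H1_0_no_trace[OF u_V nu Hv nv])
    let ?v2 = "\<lambda>x. 2 * v x"
    have n2: "\<not> has_trace \<Omega> ?v2" by (rule no_trace_double(2)[OF O Hv nv])
    have v2V: "?v2 \<in> ?V" by (rule H1_0_no_trace[OF u_V nu no_trace_double(1)[OF O Hv nv] n2])
    have "tr \<Omega> ?v2 = tr \<Omega> v" by (rule tr_eq_if_no_trace[OF n2 nv])
    \<comment> \<open>Passing from v to 2 v doubles both forms but leaves \<open>tr\<close>, hence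
      the boundary term, unchanged. The boundary term therefore equals its double and is 0.\<close>
    then have "a w v = a u v"
      using eq[OF vV] eq[OF v2V] dbl[OF vV u_V v2V] dbl[OF vV w_V v2V] by simp
    then have "a v v = 0" using lin[OF w_V u_V vV, of 1 "-1"] unfolding v_def[symmetric] by simp
    then have "AE x in lebesgue. x \<in> \<Omega> \<longrightarrow> v x = 0"
      using a_sp vV unfolding scalar_product_on_def a_def by blast
    then have "AE x in lebesgue. x \<in> \<Omega> \<longrightarrow> w x = u x"
      by eventually_elim (simp add: v_def)
    then show False using has_trace_cong_AE tw nu by blast
  qed

  \<comment> \<open>The three boundary integrals are kept apart: merging them requires
    integrability, which is available only when \<open>w\<close> has a trace.\<close>
  define T where "T = (LINT x:\<Gamma>N|surf. \<alpha> x * tr \<Omega> u x * tr \<Omega> w x)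
      - lam * (LINT x:\<Gamma>N|surf. tr \<Omega> u x * tr \<Omega> w x) + (LINT x:\<Gamma>N|surf. qn x * tr \<Omega> w x)"
  have CF: "CF \<ge> 0" "L2_norm lebesgue \<Omega> w \<le> CF * N"
    using CF_def w_V unfolding least_real_def N_def a_def by blast+
  have CT: "CT \<ge> 0" "L2_norm surf \<Gamma>N (tr \<Omega> w) \<le> CT * N"
    using CT_def w_V unfolding least_real_def N_def a_def by blast+
  have aww: "a w w \<ge> 0" using a_sp w_V unfolding scalar_product_on_def a_def by blast
  have N: "N \<ge> 0" "N\<^sup>2 = a w w" using aww by (simp_all add: N_def)
  have Nnn: "N2 \<ge> 0" "N3 \<ge> 0" by (simp_all add: N2_def N3_def L2_norm_nonneg)
  have N1: "N1 \<ge> 0"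
  proof -
    have "0 \<le> (LINT x:\<Omega>|lebesgue. (A x *v y x) \<bullet> y x)"
      unfolding set_integral_eq_mult
      by (rule integral_nonneg_AE) (use psd in eventually_elim, auto simp: indicator_def inner_commute)
    then show ?thesis by (simp add: N1_def)
  qed
  have green: "(LINT x:\<Omega>|lebesgue. q x \<bullet> grad \<Omega> v x) + (LINT x:\<Omega>|lebesgue. divg \<Omega> q x * v x)
        = (LINT x:\<Gamma>N|surf. qn x * tr \<Omega> v x)" if "v \<in> ?V" for v
    using q_normal that unfolding normal_trace_on_def by blast

  have T: "T \<le> CT * N3 * N"
  proof (cases "has_trace \<Omega> w")
    case True
    have tu: "L2 surf \<Gamma>N (tr \<Omega> u)" and tw: "L2 surf \<Gamma>N (tr \<Omega> w)"
      by (intro L2_subset[OF tr_L2 GN_sub GN] True trace_u)+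
    have tq: "L2 surf \<Gamma>N qn" using q_normal by (simp add: normal_trace_on_def)
    have au: "L2 surf \<Gamma>N (\<lambda>x. \<alpha> x * tr \<Omega> u x)" by (rule L2_Linf_mult[OF alpha_Linf tu])
    have "T = (LINT x:\<Gamma>N|surf. (\<alpha> x * tr \<Omega> u x) * tr \<Omega> w x - lam * (tr \<Omega> u x * tr \<Omega> w x)
        + qn x * tr \<Omega> w x)"
      using L2_mult_integrable[OF au tw] L2_mult_integrable[OF tu tw] L2_mult_integrable[OF tq tw]
      by (simp add: T_def)
    also have "\<dots> = (LINT x:\<Gamma>N|surf. (\<alpha> x * tr \<Omega> u x - lam * tr \<Omega> u x + qn x) * tr \<Omega> w x)"
      by (simp add: algebra_simps)
    also have "\<dots> \<le> \<bar>\<dots>\<bar>" by simp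
    also have "\<dots> \<le> N3 * L2_norm surf \<Gamma>N (tr \<Omega> w)"
      unfolding N3_def by (intro L2_Cauchy_Schwarz L2_add L2_diff L2_cmult au tu tw tq)
    also have "\<dots> \<le> N3 * (CT * N)" by (intro mult_left_mono CT Nnn)
    finally show ?thesis by (simp add: mult_ac)
  next
    case False
    let ?w2 = "\<lambda>x. 2 * w x"
    have n2: "\<not> has_trace \<Omega> ?w2" by (rule no_trace_double(2)[OF O Hw False])
    have w2V: "?w2 \<in> ?V" by (rule H1_0_no_trace[OF w_V False no_trace_double(1)[OF O Hw False] n2])
    have tr2: "tr \<Omega> ?w2 = tr \<Omega> w" by (rule tr_eq_if_no_trace[OF n2 False])
    have g2: "AE x in lebesgue. x \<in> \<Omega> \<longrightarrow> grad \<Omega> ?w2 x = 2 *\<^sub>R grad \<Omega> w x"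
      using H1_lincomb(2)[OF O Hw Hw, of 2 0] by eventually_elim simp
    \<comment> \<open>The chosen gradient of 2 w is twice that of w only almost everywhere, which
      suffices under the integral.\<close>
    have i2: "(LINT x:\<Omega>|lebesgue. f x \<bullet> grad \<Omega> ?w2 x) = 2 * (LINT x:\<Omega>|lebesgue. f x \<bullet> grad \<Omega> w x)" for f
    proof -
      have "(LINT x:\<Omega>|lebesgue. f x \<bullet> grad \<Omega> ?w2 x) = (LINT x:\<Omega>|lebesgue. 2 * (f x \<bullet> grad \<Omega> w x))"
        by (rule set_integral_lebesgue_cong_AE) (use g2 in eventually_elim, simp)
      then show ?thesis by simp
    qed
    have j2: "(LINT x:\<Omega>|lebesgue. f x * ?w2 x) = 2 * (LINT x:\<Omega>|lebesgue. f x * w x)" for f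
      using set_integral_mult_right[where a = 2 and f = "\<lambda>x. f x * w x" and M = lebesgue and A = \<Omega>]
      by (simp add: mult_ac)
    \<comment> \<open>Comparing \<open>w\<close> with 2 w in the equation for \<open>w\<close>, in
      Green's formula and in the form \<open>a\<close> itself makes the boundary contributions
      vanish one after the other: everything else doubles, while the trace stays the same.\<close>
    have z1: "lam * (LINT x:\<Gamma>N|surf. tr \<Omega> u x * tr \<Omega> w x) = 0"
      using eq[OF w_V] eq[OF w2V] dbl[OF w_V u_V w2V] dbl[OF w_V w_V w2V] by (simp add: tr2)
    have z2: "(LINT x:\<Gamma>N|surf. qn x * tr \<Omega> w x) = 0"
      using green[OF w_V] green[OF w2V] i2 j2 by (simp add: tr2)
    have "(LINT x:\<Omega>|lebesgue. c x * u x * ?w2 x) = 2 * (LINT x:\<Omega>|lebesgue. c x * u x * w x)"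
      by (rule j2)
    then have z3: "(LINT x:\<Gamma>N|surf. \<alpha> x * tr \<Omega> u x * tr \<Omega> w x) = 0"
      using dbl[OF w_V u_V w2V] i2 unfolding a_def aform_def by (simp add: tr2)
    have "T = 0" by (simp add: T_def z1 z2 z3)
    then show ?thesis using CT Nnn N by simp
  qed

  \<comment> \<open>The terms of a(w, w) containing c and \<alpha> are nonnegative, so dropping them
    gives a lower bound.\<close>
  have gw: "sqrt (LINT x:\<Omega>|lebesgue. (A x *v grad \<Omega> w x) \<bullet> grad \<Omega> w x) \<le> N"
  proof -
    have "0 \<le> (LINT x:\<Omega>|lebesgue. c x * w x * w x)"
      unfolding set_integral_eq_mult
      by (rule integral_nonneg_AE) (use c_nonneg in eventually_elim, auto simp: indicator_def mult.assoc)
    moreover have "0 \<le> (LINT x:\<Gamma>N|surf. \<alpha> x * tr \<Omega> w x * tr \<Omega> w x)"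
      unfolding set_integral_eq_mult
      by (rule integral_nonneg_AE) (use alpha_nonneg in eventually_elim, auto simp: indicator_def mult.assoc)
    ultimately show ?thesis unfolding N_def a_def aform_def by (intro real_sqrt_le_mono) simp
  qed

  have V1: "(LINT x:\<Omega>|lebesgue. (A x *v grad \<Omega> u x) \<bullet> grad \<Omega> w x) - (LINT x:\<Omega>|lebesgue. q x \<bullet> grad \<Omega> w x)
      \<le> N1 * N"
  proof -
    have "(LINT x:\<Omega>|lebesgue. (A x *v grad \<Omega> u x) \<bullet> grad \<Omega> w x) - (LINT x:\<Omega>|lebesgue. q x \<bullet> grad \<Omega> w x)
        = (LINT x:\<Omega>|lebesgue. (A x *v grad \<Omega> u x) \<bullet> grad \<Omega> w x - q x \<bullet> grad \<Omega> w x)"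
      by (rule set_integral_diff(2)[symmetric])
        (intro L2_inner_integrable L2_matrix_vector_mult A_Linf Gu Gw Lq)+
    \<comment> \<open>Since A A^(-1) q = q almost everywhere, A grad u - q equals A y, which brings
      the integral into the form for Cauchy-Schwarz in the product weighted by A.\<close>
    also have "\<dots> = (LINT x:\<Omega>|lebesgue. (A x *v y x) \<bullet> grad \<Omega> w x)"
    proof (rule set_integral_lebesgue_cong_AE)
      show "AE x in lebesgue. x \<in> \<Omega> \<longrightarrow> (A x *v grad \<Omega> u x) \<bullet> grad \<Omega> w x - q x \<bullet> grad \<Omega> w x
          = (A x *v y x) \<bullet> grad \<Omega> w x"
        using a0(2)
      proof eventually_elim
        case (elim x)
        show ?case
        proof
          assume "x \<in> \<Omega>"
          then have "A x *v (matrix_inv (A x) *v q x) = q x"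
            using elim positive_definite_matrix_inv(2)[OF a0(1)] by blast
          then have "A x *v y x = A x *v grad \<Omega> u x - q x"
            by (simp add: y_def matrix_vector_mult_diff_distrib)
          then show "(A x *v grad \<Omega> u x) \<bullet> grad \<Omega> w x - q x \<bullet> grad \<Omega> w x = (A x *v y x) \<bullet> grad \<Omega> w x"
            by (simp add: inner_diff_left)
        qed
      qed
    qed
    also have "\<dots> \<le> \<bar>\<dots>\<bar>" by simp
    also have "\<dots> \<le> N1 * sqrt (LINT x:\<Omega>|lebesgue. (A x *v grad \<Omega> w x) \<bullet> grad \<Omega> w x)"
      unfolding N1_def by (rule quadratic_form_Cauchy_Schwarz[OF A_Linf A_sym psd Ly Gw])
    also have "\<dots> \<le> N1 * N" by (intro mult_left_mono gw N1)
    finally show ?thesis .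
  qed

  have V2: "(LINT x:\<Omega>|lebesgue. c x * u x * w x) - (LINT x:\<Omega>|lebesgue. divg \<Omega> q x * w x) \<le> CF * N2 * N"
  proof -
    have cu: "L2 lebesgue \<Omega> (\<lambda>x. c x * u x)" by (rule L2_Linf_mult[OF c_Linf Lu])
    have "(LINT x:\<Omega>|lebesgue. c x * u x * w x) - (LINT x:\<Omega>|lebesgue. divg \<Omega> q x * w x)
       = (LINT x:\<Omega>|lebesgue. (c x * u x - divg \<Omega> q x) * w x)"
      using L2_mult_integrable[OF cu Lw] L2_mult_integrable[OF Ld Lw] by (simp add: left_diff_distrib)
    also have "\<dots> \<le> \<bar>\<dots>\<bar>" by simp
    also have "\<dots> \<le> N2 * L2_norm lebesgue \<Omega> w"
      unfolding N2_def by (intro L2_Cauchy_Schwarz L2_diff cu Ld Lw)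
    also have "\<dots> \<le> N2 * (CF * N)" by (intro mult_left_mono CF Nnn)
    finally show ?thesis by (simp add: mult_ac)
  qed

  have "N * N = a u w - lam * (LINT x:\<Gamma>N|surf. tr \<Omega> u x * tr \<Omega> w x)"
    using N(2) eq[OF w_V] by (simp add: power2_eq_square)
  \<comment> \<open>Green's formula tested with \<open>w\<close> is inserted: both volume integrals
    of q are subtracted, and T contains the boundary integral that compensates them.\<close>
  also have "\<dots> = ((LINT x:\<Omega>|lebesgue. (A x *v grad \<Omega> u x) \<bullet> grad \<Omega> w x) - (LINT x:\<Omega>|lebesgue. q x \<bullet> grad \<Omega> w x))
      + ((LINT x:\<Omega>|lebesgue. c x * u x * w x) - (LINT x:\<Omega>|lebesgue. divg \<Omega> q x * w x)) + T"
    using green[OF w_V] unfolding T_def a_def aform_def by simp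
  also have "\<dots> \<le> N1 * N + CF * N2 * N + CT * N3 * N" using V1 V2 T by simp
  also have "\<dots> = (N1 + CF * N2 + CT * N3) * N" by (simp add: algebra_simps)
  finally have fin: "N * N \<le> (N1 + CF * N2 + CT * N3) * N" .
  have "N \<le> N1 + CF * N2 + CT * N3"
  \<comment> \<open>Division by N needs N \<noteq> 0; for N = 0 the right-hand side is a sum of
    nonnegative terms.\<close>
  proof (cases "N = 0")
    case True
    then show ?thesis using N1 CF(1) CT(1) Nnn by simp
  next
    case False
    then show ?thesis using fin N(1) by simp
  qed
  then show ?thesis unfolding N_def N1_def N2_def N3_def a_def y_def .
qed

end
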